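(* Let $X$ be a finite dimensional real normed linear space which is smooth and strictly convex and let $d=\dim X$. Let $G=(V,E)$ be a finite simple graph and suppose $G'$ is obtained from $G$ by a $d$-dimensional $0$-extension on $S\subseteq V$, where $|S|=d$. Then: (a) $G$ is independent in $X$ if and only if $G'$ is independent in $X$; and (b) $G$ is minimally rigid in $X$ if and only if $G'$ is minimally rigid in $X$.
   Context: $0$-extension: given $G=(V,E)$ and $S\subseteq V$ with $|S|=d$, the graph $G'$ obtained by a $d$-dimensional $0$-extension on $S$ has $V(G')=V\cup\{v\}$ with $v\notin V$ a new vertex, and $E(G')=E\cup\{vw:w\in S\}$. Let $X$ be a finite dimensional real normed space with dual $X^*$. A linear functional $f:X\to\mathbb{R}$ supports a non-zero point $x_0\in X$ if $f(x_0)=\|x_0\|^2$ and $\sup_{\|x\|\le1}|f(x)|=\|x_0\|$. If exactly one linear functional supports $x_0$ then $x_0$ is called smooth and $\varphi_{x_0}$ denotes this functional. $X$ is smooth if every non-zero point is smooth, and strictly convex if $\|x+y\|<\|x\|+\|y\|$ whenever $x,y$ are non-zero and $x$ is not a scalar multiple of $y$ (equivalently, if the closed unit ball of $X$ is strictly convex). A placement of $G=(V,E)$ in $X$ is a point $p=(p_v)_{v\in V}\in X^V$ with $p_v\neq p_w$ for each $vw\in E$; it is well-positioned if $p_v-p_w$ is smooth for every $vw\in E$. Fix a basis $b_1,\dots,b_d$ of $X$. For well-positioned $p$, the rigidity matrix $R(G,p)$ has rows indexed by $E$ and columns indexed by $V\times\{1,\dots,d\}$; for $e=vw$ its $(e,(v,k))$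 entry is $\varphi_{p_v-p_w}(b_k)$, its $(e,(w,k))$ entry is $\varphi_{p_w-p_v}(b_k)=-\varphi_{p_v-p_w}(b_k)$, and the remaining entries of row $e$ are $0$. $(G,p)$ is independent if the rows of $R(G,p)$ are linearly independent, and regular if $\operatorname{rank}R(G,p)$ is maximal among all well-positioned placements of $G$ in $X$. Let $\mathcal{O}_p$ be the set of $p'\in X^V$ for which there is an isometry $T:X\to X$ with $p_v=T(p'_v)$ for all $v\in V$; it is a smooth submanifold of $X^V$, and $\mathcal{T}(p)$ denotes its tangent space at $p$. A regular framework $(G,p)$ is rigid in $X$ if $\operatorname{rank}R(G,p)=d|V|-\dim\mathcal{T}(p)$, and minimally rigid if it is rigid and independent. The graph $G$ is independent (resp. rigid, minimally rigid) in $X$ if $(G,p)$ is independent (resp. rigid, minimally rigid) for some placement $p$. *)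

theory Defs
  imports "HOL-Analysis.Analysis" "HOL-Library.Function_Algebras"
begin

text \<open>
  Pointwise real vector space structure on functions, so that \<^const>\<open>dim\<close>,
  \<^const>\<open>span\<close> and \<^const>\<open>independent\<close> apply to matrix rows and to
  families of vectors indexed by vertices.
\<close>

instantiation "fun" :: (type, real_vector) real_vector
begin

definition scaleR_fun_def: "c *\<^sub>R f = (\<lambda>x. c *\<^sub>R f x)"

instance
  by standard (simp_all add: scaleR_fun_def fun_eq_iff scaleR_add_right scaleR_add_left)

end

section \<open>Normed spaces\<close>

text \<open>In a finite dimensional space every linear functional is bounded, so the supremum is
  a genuine one.\<close>

definition supports :: "('a::real_normed_vector \<Rightarrow> real) \<Rightarrow> 'a \<Rightarrow> bool" where
  "supports f x0 \<longleftrightarrow>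
     linear f \<and> f x0 = (norm x0)\<^sup>2 \<and> (SUP x\<in>{x. norm x \<le> 1}. \<bar>f x\<bar>) = norm x0"

definition smooth_point :: "'a::real_normed_vector \<Rightarrow> bool" where
  "smooth_point x0 \<longleftrightarrow> x0 \<noteq> 0 \<and> (\<exists>!f. supports f x0)"

definition support_functional :: "'a::real_normed_vector \<Rightarrow> 'a \<Rightarrow> real" where
  "support_functional x0 = (THE f. supports f x0)"

definition smooth_space :: "'a::real_normed_vector itself \<Rightarrow> bool" where
  "smooth_space _ \<longleftrightarrow> (\<forall>x::'a. x \<noteq> 0 \<longrightarrow> smooth_point x)"

definition strictly_convex_space :: "'a::real_normed_vector itself \<Rightarrow> bool" where
  "strictly_convex_space _ \<longleftrightarrow>
     (\<forall>x y::'a. x \<noteq> 0 \<and> y \<noteq> 0 \<and> (\<nexists>c. x = c *\<^sub>R y) \<longrightarrow> norm (x + y) < norm x + norm y)"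

definition ordered_basis :: "(nat \<Rightarrow> 'a::real_vector) \<Rightarrow> bool" where
  "ordered_basis b \<longleftrightarrow>
     inj_on b {1..dim (UNIV :: 'a set)} \<and>
     independent (b ` {1..dim (UNIV :: 'a set)}) \<and>
     span (b ` {1..dim (UNIV :: 'a set)}) = UNIV"

definition isometry_map :: "('a::metric_space \<Rightarrow> 'a) \<Rightarrow> bool" where
  "isometry_map T \<longleftrightarrow> (\<forall>x y. dist (T x) (T y) = dist x y)"

section \<open>Graphs\<close>

text \<open>A graph is given by its vertex set and its set of edges, an edge being an unordered
  pair of distinct vertices.\<close>

definition finite_simple_graph :: "'v set \<Rightarrow> 'v set set \<Rightarrow> bool" where
  "finite_simple_graph V E \<longleftrightarrow>
     finite V \<and> (\<forall>e\<in>E. \<exists>v w. v \<in> V \<and> w \<in> V \<and> v \<noteq> w \<and> e = {v, w})"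

definition zero_extension ::
  "nat \<Rightarrow> 'v set \<Rightarrow> 'v set \<Rightarrow> 'v set set \<Rightarrow> 'v set \<Rightarrow> 'v set set \<Rightarrow> bool" where
  "zero_extension d S V E V' E' \<longleftrightarrow>
     S \<subseteq> V \<and> card S = d \<and>
     (\<exists>v. v \<notin> V \<and> V' = insert v V \<and> E' = E \<union> {{v, w} | w. w \<in> S})"

section \<open>Frameworks\<close>

text \<open>The space \<open>X\<^sup>V\<close> is represented by the functions on the vertex type that vanish
  outside \<open>V\<close>.\<close>

definition config_space :: "'v set \<Rightarrow> ('v \<Rightarrow> 'a::real_normed_vector) set" where
  "config_space V = {p. \<forall>v. v \<notin> V \<longrightarrow> p v = 0}"

definition placement ::
  "'v set \<Rightarrow> 'v set set \<Rightarrow> ('v \<Rightarrow> 'a::real_normed_vector) \<Rightarrow> bool" where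
  "placement V E p \<longleftrightarrow>
     p \<in> config_space V \<and> (\<forall>v w. {v, w} \<in> E \<longrightarrow> p v \<noteq> p w)"

definition well_positioned ::
  "'v set \<Rightarrow> 'v set set \<Rightarrow> ('v \<Rightarrow> 'a::real_normed_vector) \<Rightarrow> bool" where
  "well_positioned V E p \<longleftrightarrow>
     placement V E p \<and> (\<forall>v w. {v, w} \<in> E \<longrightarrow> smooth_point (p v - p w))"

text \<open>The row of \<open>e\<close>, as a function of the column index \<open>(u, k)\<close>. Its entry at an endpoint
  \<open>u\<close> is the support functional of \<open>p u - p w\<close>, evaluated at \<open>b k\<close>, where \<open>w\<close> is the other
  endpoint; no orientation of the edge is involved. The entry is \<open>0\<close> when \<open>k\<close> is not in
  \<open>{1..d}\<close>, so only columns in \<open>V \<times> {1..d}\<close> matter.\<close>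

definition rigidity_row ::
  "(nat \<Rightarrow> 'a::real_normed_vector) \<Rightarrow> ('v \<Rightarrow> 'a) \<Rightarrow> 'v set \<Rightarrow> 'v \<times> nat \<Rightarrow> real" where
  "rigidity_row b p e =
     (\<lambda>(u, k). if u \<in> e \<and> k \<in> {1..dim (UNIV :: 'a set)}
        then support_functional (p u - p (THE w. e = {u, w})) (b k) else 0)"

definition rigidity_rank ::
  "(nat \<Rightarrow> 'a::real_normed_vector) \<Rightarrow> 'v set set \<Rightarrow> ('v \<Rightarrow> 'a) \<Rightarrow> nat" where
  "rigidity_rank b E p = dim (rigidity_row b p ` E)"

definition independent_framework ::
  "(nat \<Rightarrow> 'a::real_normed_vector) \<Rightarrow> 'v set \<Rightarrow> 'v set set \<Rightarrow> ('v \<Rightarrow> 'a) \<Rightarrow> bool" where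
  "independent_framework b V E p \<longleftrightarrow>
     well_positioned V E p \<and>
     inj_on (rigidity_row b p) E \<and> independent (rigidity_row b p ` E)"

definition regular_framework ::
  "(nat \<Rightarrow> 'a::real_normed_vector) \<Rightarrow> 'v set \<Rightarrow> 'v set set \<Rightarrow> ('v \<Rightarrow> 'a) \<Rightarrow> bool" where
  "regular_framework b V E p \<longleftrightarrow>
     well_positioned V E p \<and>
     (\<forall>q. well_positioned V E q \<longrightarrow> rigidity_rank b E q \<le> rigidity_rank b E p)"

definition isometry_orbit ::
  "'v set \<Rightarrow> ('v \<Rightarrow> 'a::real_normed_vector) \<Rightarrow> ('v \<Rightarrow> 'a) set" where
  "isometry_orbit V p =
     {p' \<in> config_space V. \<exists>T. isometry_map T \<and> (\<forall>v\<in>V. p v = T (p' v))}"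

text \<open>The tangent space at \<open>p\<close> of a submanifold \<open>M\<close> of \<open>X\<^sup>V\<close>: the velocities at time \<open>0\<close> of
  the continuously differentiable curves in \<open>M\<close> that pass through \<open>p\<close> at time \<open>0\<close>. Since \<open>V\<close>
  is finite, curves in \<open>X\<^sup>V\<close> are differentiated coordinatewise.\<close>

definition tangent_space ::
  "('v \<Rightarrow> 'a::real_normed_vector) set \<Rightarrow> ('v \<Rightarrow> 'a) \<Rightarrow> ('v \<Rightarrow> 'a) set" where
  "tangent_space M p =
     {u. \<exists>\<gamma> \<epsilon>. \<epsilon> > 0 \<and> \<gamma> 0 = p \<and> (\<forall>t\<in>{-\<epsilon><..<\<epsilon>}. \<gamma> t \<in> M) \<and>
           (\<forall>v. (\<lambda>t. \<gamma> t v) C1_differentiable_on {-\<epsilon><..<\<epsilon>} \<and>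
                ((\<lambda>t. \<gamma> t v) has_vector_derivative u v) (at 0))}"

definition rigid_framework ::
  "(nat \<Rightarrow> 'a::real_normed_vector) \<Rightarrow> 'v set \<Rightarrow> 'v set set \<Rightarrow> ('v \<Rightarrow> 'a) \<Rightarrow> bool" where
  "rigid_framework b V E p \<longleftrightarrow>
     regular_framework b V E p \<and>
     int (rigidity_rank b E p) =
       int (dim (UNIV :: 'a set) * card V) - int (dim (tangent_space (isometry_orbit V p) p))"

definition minimally_rigid_framework ::
  "(nat \<Rightarrow> 'a::real_normed_vector) \<Rightarrow> 'v set \<Rightarrow> 'v set set \<Rightarrow> ('v \<Rightarrow> 'a) \<Rightarrow> bool" where
  "minimally_rigid_framework b V E p \<longleftrightarrow>
     rigid_framework b V E p \<and> independent_framework b V E p"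

definition independent_graph ::
  "(nat \<Rightarrow> 'a::real_normed_vector) \<Rightarrow> 'v set \<Rightarrow> 'v set set \<Rightarrow> bool" where
  "independent_graph b V E \<longleftrightarrow> (\<exists>p. independent_framework b V E p)"

definition minimally_rigid_graph ::
  "(nat \<Rightarrow> 'a::real_normed_vector) \<Rightarrow> 'v set \<Rightarrow> 'v set set \<Rightarrow> bool" where
  "minimally_rigid_graph b V E \<longleftrightarrow> (\<exists>p. minimally_rigid_framework b V E p)"

end

theory Submission
  imports Defs
begin

text \<open>
  Let \<open>\<phi> x\<close> denote the support functional of \<open>x\<close>. It depends continuously on \<open>x\<close>, and if \<open>\<phi> y\<close>
  annihilates \<open>z \<noteq> 0\<close>, then by strict convexity no \<open>\<phi> (y + s z)\<close> with \<open>s \<noteq> 0\<close> does. Since linear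
  independence of the rows of the rigidity matrix is an open condition, the points of \<open>S\<close> can
  therefore be moved slightly so that the functionals \<open>\<phi> (x - p w)\<close>, \<open>w \<in> S\<close>, form a basis of the
  dual space, where \<open>x\<close> is the position of the new vertex. The rows of the new edges are then
  independent modulo the columns of \<open>V\<close>.

  For rigidity, the tangent space of the orbit of \<open>p\<close> spans the space of restrictions to \<open>p\<close> of the
  affine vector fields \<open>y \<mapsto> A y + c\<close> with \<open>\<phi> y (A y) = 0\<close> for all \<open>y\<close>. It is orthogonal to the rows, so
  a framework with independent rows is minimally rigid as soon as \<open>d |V| - |E|\<close> such fields are
  independent at \<open>p\<close>, again an open condition. Fields independent on \<open>V\<close> are independent on
  \<open>V \<union> {v}\<close>, and conversely a field that vanishes at the points of \<open>S\<close> is annihilated at \<open>x\<close> by all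
  \<open>\<phi> (x - p w)\<close>, hence vanishes at \<open>x\<close>.
\<close>

section \<open>Finite families of real functions\<close>

text \<open>Families instead of sets: equal members count as dependent, as is right for matrix rows.
  The set \<open>I\<close> selects columns, so that blocks of the rigidity matrix can be treated
  separately.\<close>

definition indep_family :: "'j set \<Rightarrow> 'i set \<Rightarrow> ('j \<Rightarrow> 'i \<Rightarrow> real) \<Rightarrow> bool" where
  "indep_family J I f \<longleftrightarrow>
     (\<forall>c. (\<forall>i\<in>I. (\<Sum>j\<in>J. c j * f j i) = 0) \<longrightarrow> (\<forall>j\<in>J. c j = 0))"

lemma indep_familyI:
  assumes "\<And>c j. (\<And>i. i \<in> I \<Longrightarrow> (\<Sum>j\<in>J. c j * f j i) = 0) \<Longrightarrow> j \<in> J \<Longrightarrow> c j = 0"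
  shows "indep_family J I f"
  unfolding indep_family_def using assms by blast

lemma indep_familyD:
  assumes "indep_family J I f" "\<And>i. i \<in> I \<Longrightarrow> (\<Sum>j\<in>J. c j * f j i) = 0" "j \<in> J"
  shows "c j = 0"
  using assms unfolding indep_family_def by blast

lemma indep_family_cong:
  assumes "\<And>j i. j \<in> J \<Longrightarrow> i \<in> I \<Longrightarrow> f j i = g j i"
  shows "indep_family J I f \<longleftrightarrow> indep_family J I g"
  using assms unfolding indep_family_def by (simp cong: sum.cong)

lemma indep_family_subset:
  assumes "indep_family J I f" "finite J" "J' \<subseteq> J"
  shows "indep_family J' I f"
proof (rule indep_familyI)
  fix c j assume c: "\<And>i. i \<in> I \<Longrightarrow> (\<Sum>j\<in>J'. c j * f j i) = 0" and j: "j \<in> J'"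
  let ?c = "\<lambda>j. if j \<in> J' then c j else 0"
  have "(\<Sum>j\<in>J. ?c j * f j i) = (\<Sum>j\<in>J'. c j * f j i)" for i
    using assms(2,3) by (intro sum.mono_neutral_cong_right) auto
  then have "?c j = 0"
    using indep_familyD[OF assms(1), of ?c j] c j assms(3) by auto
  then show "c j = 0" using j by simp
qed

lemma sum_fun_apply: "(\<Sum>j\<in>J. f j) i = (\<Sum>j\<in>J. f j i)"
  for f :: "'j \<Rightarrow> 'i \<Rightarrow> 'b::comm_monoid_add"
  by (induction J rule: infinite_finite_induct) auto

text \<open>A collision \<open>f x = f y\<close> is itself a relation, with coefficients 1 and -1,
  so triviality of all relations yields injectivity along with independence of the image.\<close>

lemma independent_image_iff:
  fixes f :: "'j \<Rightarrow> 'b::real_vector"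
  assumes "finite J"
  shows "inj_on f J \<and> independent (f ` J) \<longleftrightarrow>
    (\<forall>c. (\<Sum>j\<in>J. c j *\<^sub>R f j) = 0 \<longrightarrow> (\<forall>j\<in>J. c j = 0))"
proof (intro iffI allI impI ballI)
  fix c j
  assume L: "inj_on f J \<and> independent (f ` J)" and c: "(\<Sum>j\<in>J. c j *\<^sub>R f j) = 0" and j: "j \<in> J"
  let ?u = "\<lambda>x. c (inv_into J f x)"
  have "(\<Sum>x\<in>f ` J. ?u x *\<^sub>R x) = 0" using L c by (simp add: sum.reindex)
  then have "?u (f j) = 0"
    using L j assms by (intro real_vector.independentD[of "f ` J" "f ` J"]) auto
  then show "c j = 0" using L j by simp
next
  assume R: "\<forall>c. (\<Sum>j\<in>J. c j *\<^sub>R f j) = 0 \<longrightarrow> (\<forall>j\<in>J. c j = 0)"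
  have inj: "inj_on f J"
  proof (rule inj_onI, rule ccontr)
    fix x y assume xy: "x \<in> J" "y \<in> J" "f x = f y" "x \<noteq> y"
    define c where "c = (\<lambda>j. if j = x then 1 else if j = y then -1 else (0::real))"
    have "(\<Sum>j\<in>J. c j *\<^sub>R f j) = (\<Sum>j\<in>{x,y}. c j *\<^sub>R f j)"
      using assms xy by (intro sum.mono_neutral_right) (auto simp: c_def)
    then have "(\<Sum>j\<in>J. c j *\<^sub>R f j) = 0" using xy by (simp add: c_def)
    then have "c x = 0" using R xy(1) by blast
    then show False by (simp add: c_def)
  qed
  moreover have "independent (f ` J)"
  proof (rule real_vector.independent_if_scalars_zero)
    fix u x assume u: "(\<Sum>x\<in>f ` J. u x *\<^sub>R x) = 0" and x: "x \<in> f ` J"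
    then show "u x = 0" using R[rule_format, of "\<lambda>j. u (f j)"] by (auto simp: sum.reindex[OF inj])
  qed (use assms in auto)
  ultimately show "inj_on f J \<and> independent (f ` J)" ..
qed

lemma indep_family_UNIV_iff:
  "finite J \<Longrightarrow> indep_family J UNIV f \<longleftrightarrow> inj_on f J \<and> independent (f ` J)"
  by (simp add: independent_image_iff indep_family_def sum_fun_apply scaleR_fun_def fun_eq_iff)

lemma indep_family_mono: "indep_family J I f \<Longrightarrow> I \<subseteq> I' \<Longrightarrow> indep_family J I' f"
  unfolding indep_family_def by blast

lemma indep_family_drop:
  assumes "indep_family J I f" "\<And>j i. j \<in> J \<Longrightarrow> i \<in> I - I' \<Longrightarrow> f j i = 0"
  shows "indep_family J I' f"
proof (rule indep_familyI)
  fix c j assume c: "\<And>i. i \<in> I' \<Longrightarrow> (\<Sum>j\<in>J. c j * f j i) = 0" and j: "j \<in> J"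
  have "(\<Sum>j\<in>J. c j * f j i) = 0" if "i \<in> I" for i
    using c[of i] assms(2)[of _ i] that by (cases "i \<in> I'") auto
  then show "c j = 0" using indep_familyD[OF assms(1)] j by blast
qed

lemma indep_family_UNIV_eq:
  assumes "\<And>j i. j \<in> J \<Longrightarrow> i \<notin> I \<Longrightarrow> f j i = 0"
  shows "indep_family J UNIV f \<longleftrightarrow> indep_family J I f"
  using indep_family_drop[of J UNIV f I] indep_family_mono[of J I f UNIV] assms by blast

text \<open>Extended by 0 outside \<open>I\<close>, the members lie in the span of the unit vectors
  \<open>e k\<close> with \<open>k \<in> I\<close>.\<close>

lemma indep_family_card_le:
  fixes f :: "'j \<Rightarrow> 'i \<Rightarrow> real"
  assumes J: "finite J" and I: "finite I" and f: "indep_family J I f"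
  shows "card J \<le> card I"
proof -
  define g where "g = (\<lambda>j i. if i \<in> I then f j i else 0)"
  define e :: "'i \<Rightarrow> 'i \<Rightarrow> real" where "e = (\<lambda>k i. if i = k then 1 else 0)"
  have "indep_family J I g" using f by (subst indep_family_cong[of _ _ _ f]) (auto simp: g_def)
  then have "indep_family J UNIV g" by (rule indep_family_mono) simp
  then have g: "inj_on g J" "independent (g ` J)" using indep_family_UNIV_iff[OF J] by auto
  have "g j = (\<Sum>k\<in>I. f j k *\<^sub>R e k)" for j
    using I by (auto simp: g_def e_def sum_fun_apply scaleR_fun_def fun_eq_iff if_distrib sum.delta'
        cong: if_cong)
  then have "g ` J \<subseteq> span (e ` I)"
    by (auto intro!: real_vector.span_sum real_vector.span_scale intro: real_vector.span_base)
  then have "card (g ` J) \<le> card (e ` I)"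
    using real_vector.independent_span_bound[of "e ` I" "g ` J"] g I by auto
  also have "\<dots> \<le> card I" by (rule card_image_le[OF I])
  finally show ?thesis using g(1) by (simp add: card_image)
qed

text \<open>A vector lying in the spans of both families is orthogonal to itself.\<close>

lemma indep_family_orthogonal_card_le:
  assumes fin: "finite J" "finite K" "finite I"
    and f: "indep_family J I f" and g: "indep_family K I g"
    and orth: "\<And>j k. j \<in> J \<Longrightarrow> k \<in> K \<Longrightarrow> (\<Sum>i\<in>I. f j i * g k i) = 0"
  shows "card J + card K \<le> card I"
proof -
  define h where "h = case_sum f g"
  have "indep_family (J <+> K) I h"
  proof (rule indep_familyI)
    fix c l
    assume c: "\<And>i. i \<in> I \<Longrightarrow> (\<Sum>l\<in>J <+> K. c l * h l i) = 0" and l: "l \<in> J <+> K"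
    define x where "x = (\<lambda>i. \<Sum>j\<in>J. c (Inl j) * f j i)"
    define y where "y = (\<lambda>i. \<Sum>k\<in>K. c (Inr k) * g k i)"
    have xy: "x i + y i = 0" if "i \<in> I" for i
      using c[OF that] fin by (simp add: h_def sum.Plus x_def y_def)
    have "(\<Sum>i\<in>I. x i * y i) =
        (\<Sum>i\<in>I. \<Sum>j\<in>J. \<Sum>k\<in>K. c (Inl j) * c (Inr k) * (f j i * g k i))"
      by (simp add: x_def y_def sum_product mult_ac)
    also have "\<dots> = (\<Sum>j\<in>J. \<Sum>k\<in>K. \<Sum>i\<in>I. c (Inl j) * c (Inr k) * (f j i * g k i))"
      by (subst sum.swap, subst sum.swap[where A = I and B = K]) simp
    also have "\<dots> = 0" using orth by (simp flip: sum_distrib_left)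
    finally have "(\<Sum>i\<in>I. x i * y i) = 0" .
    moreover have "x i * y i = - (x i * x i)" if "i \<in> I" for i
      using xy[OF that] by (simp add: add_eq_0_iff)
    ultimately have "(\<Sum>i\<in>I. x i * x i) = 0" by (simp add: sum_negf)
    then have x: "x i = 0" if "i \<in> I" for i
      using fin(3) that by (subst (asm) sum_nonneg_eq_0_iff) auto
    then have y: "y i = 0" if "i \<in> I" for i using xy that by force
    show "c l = 0"
      using l indep_familyD[OF f, of "\<lambda>j. c (Inl j)"] indep_familyD[OF g, of "\<lambda>k. c (Inr k)"] x y
      by (auto simp: x_def y_def)
  qed
  then have "card (J <+> K) \<le> card I" using fin by (intro indep_family_card_le) auto
  then show ?thesis using fin by (simp add: card_Plus)
qed

section \<open>Compactness in finitely many coordinates and stability of independence\<close>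

text \<open>Bolzano-Weierstrass, extracting one further subsequence for each index.\<close>

lemma bounded_family_convergent_subsequence:
  fixes c :: "nat \<Rightarrow> 'j \<Rightarrow> real"
  assumes "finite J" "\<And>n j. j \<in> J \<Longrightarrow> \<bar>c n j\<bar> \<le> M"
  shows "\<exists>r l. strict_mono r \<and> (\<forall>j\<in>J. (\<lambda>n. c (r n) j) \<longlonglongrightarrow> l j)"
  using assms
proof (induction J rule: finite_induct)
  case empty
  show ?case by (auto intro: exI[of _ id] simp: strict_mono_def)
next
  case (insert j J)
  then obtain r l where r: "strict_mono r" "\<And>j. j \<in> J \<Longrightarrow> (\<lambda>n. c (r n) j) \<longlonglongrightarrow> l j"
    by blast
  have "\<And>n. c (r n) j \<in> {-M..M}" using insert.prems by (simp add: abs_le_iff minus_le_iff)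
  then obtain a s where s: "strict_mono s" "(\<lambda>n. c (r (s n)) j) \<longlonglongrightarrow> a"
    using seq_compactE[of "{-M..M}" "\<lambda>n. c (r n) j"] compact_Icc[of "-M" M]
    unfolding compact_eq_seq_compact_metric comp_def by metis
  have "\<forall>k\<in>insert j J. (\<lambda>n. c ((r \<circ> s) n) k) \<longlonglongrightarrow> (l(j := a)) k"
    using s r(2) insert.hyps(2) LIMSEQ_subseq_LIMSEQ[OF r(2) s(1)] by (auto simp: comp_def)
  then show ?case using strict_mono_o[OF r(1) s(1)] by blast
qed

text \<open>The normalised coefficients of dependence relations along a sequence accumulate at those of
  a relation in the limit.\<close>

lemma indep_family_eventually:
  fixes f :: "nat \<Rightarrow> 'j \<Rightarrow> 'i \<Rightarrow> real"
  assumes J: "finite J" and g: "indep_family J I g"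
    and lim: "\<And>j i. j \<in> J \<Longrightarrow> i \<in> I \<Longrightarrow> (\<lambda>n. f n j i) \<longlonglongrightarrow> g j i"
  shows "\<forall>\<^sub>F n in sequentially. indep_family J I (f n)"
proof (rule ccontr)
  assume "\<not> ?thesis"
  then have "\<exists>\<^sub>F n in sequentially. \<not> indep_family J I (f n)"
    by (simp add: frequently_def)
  then obtain r :: "nat \<Rightarrow> nat" where r: "strict_mono r" "\<And>n. \<not> indep_family J I (f (r n))"
    using infinite_enumerate[of "{n. \<not> indep_family J I (f n)}"]
    unfolding frequently_cofinite[symmetric] cofinite_eq_sequentially by auto
  have "\<exists>c. (\<forall>i\<in>I. (\<Sum>j\<in>J. c j * f (r n) j i) = 0) \<and> (\<Sum>j\<in>J. \<bar>c j\<bar>) = 1" for n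
  proof -
    obtain c j where c: "\<forall>i\<in>I. (\<Sum>j\<in>J. c j * f (r n) j i) = 0" "j \<in> J" "c j \<noteq> 0"
      using r(2)[of n] unfolding indep_family_def by blast
    define s where "s = (\<Sum>j\<in>J. \<bar>c j\<bar>)"
    have "s > 0" unfolding s_def using c J by (intro sum_pos2) auto
    then have "(\<Sum>j\<in>J. \<bar>c j / s\<bar>) = 1"
      by (simp add: abs_divide s_def flip: sum_divide_distrib)
    moreover have "(\<Sum>j\<in>J. c j / s * f (r n) j i) = 0" if "i \<in> I" for i
      using c that by (simp flip: sum_divide_distrib)
    ultimately show ?thesis by (intro exI[of _ "\<lambda>j. c j / s"] conjI ballI)
  qed
  then obtain c where c: "\<And>n i. i \<in> I \<Longrightarrow> (\<Sum>j\<in>J. c n j * f (r n) j i) = 0"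
    "\<And>n. (\<Sum>j\<in>J. \<bar>c n j\<bar>) = 1" by metis
  have "\<bar>c n j\<bar> \<le> 1" if "j \<in> J" for n j
    using member_le_sum[of j J "\<lambda>j. \<bar>c n j\<bar>"] that J c(2)[of n] by auto
  then obtain s l where s: "strict_mono s" "\<And>j. j \<in> J \<Longrightarrow> (\<lambda>n. c (s n) j) \<longlonglongrightarrow> l j"
    using bounded_family_convergent_subsequence[OF J, of c 1] by blast
  have "(\<lambda>n. f (r (s n)) j i) \<longlonglongrightarrow> g j i" if "j \<in> J" "i \<in> I" for j i
    using LIMSEQ_subseq_LIMSEQ[OF lim[OF that] strict_mono_o[OF r(1) s(1)]] by (simp add: comp_def)
  then have "(\<lambda>n. \<Sum>j\<in>J. c (s n) j * f (r (s n)) j i) \<longlonglongrightarrow> (\<Sum>j\<in>J. l j * g j i)"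
    if "i \<in> I" for i using s(2) that by (intro tendsto_sum tendsto_mult)
  then have "(\<Sum>j\<in>J. l j * g j i) = 0" if "i \<in> I" for i
    using that by (force simp: c(1) LIMSEQ_const_iff)
  then have "\<And>j. j \<in> J \<Longrightarrow> l j = 0" using indep_familyD[OF g] by blast
  \<comment> \<open>The normalisation passes to the limit, so the limiting coefficients cannot all
    vanish.\<close>
  moreover have "(\<lambda>n. \<Sum>j\<in>J. \<bar>c (s n) j\<bar>) \<longlonglongrightarrow> (\<Sum>j\<in>J. \<bar>l j\<bar>)"
    using s(2) by (intro tendsto_sum tendsto_rabs)
  ultimately show False using c(2) by (simp add: LIMSEQ_const_iff)
qed

section \<open>Spaces with a finite basis\<close>

text \<open>The space is an arbitrary normed space, so the topological facts of finite dimension,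
  such as continuity of coordinates and boundedness of linear maps, are derived from the basis
  \<open>b\<close>.\<close>

locale finite_basis =
  fixes b :: "nat \<Rightarrow> 'a::real_normed_vector"
    and d :: nat
  assumes dim_UNIV: "d = dim (UNIV :: 'a set)"
    and ordered_basis: "ordered_basis b"
begin

lemma basis: "inj_on b {1..d}" "independent (b ` {1..d})" "span (b ` {1..d}) = UNIV"
  using ordered_basis by (simp_all add: ordered_basis_def dim_UNIV)

text \<open>The dual basis of \<open>b\<close>.\<close>

definition coord :: "nat \<Rightarrow> 'a \<Rightarrow> real" where
  "coord k x = representation (b ` {1..d}) x (b k)"

lemma linear_coord: "linear (coord k)"
  using basis unfolding coord_def
  by (intro linearI) (auto simp: real_vector.representation_add real_vector.representation_scale)

lemma sum_coord: "(\<Sum>k=1..d. coord k x *\<^sub>R b k) = x"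
  using basis real_vector.sum_representation_eq[of "b ` {1..d}" x "b ` {1..d}"]
  unfolding coord_def by (simp add: sum.reindex)

lemma basis_scalars_zero:
  assumes "(\<Sum>k=1..d. c k *\<^sub>R b k) = 0" "k \<in> {1..d}"
  shows "c k = 0"
proof -
  have inj: "inj_on b {1..d}" by (rule basis(1))
  have "(\<Sum>x\<in>b ` {1..d}. c (inv_into {1..d} b x) *\<^sub>R x) = 0"
    using assms(1) inj by (simp add: sum.reindex)
  then have "c (inv_into {1..d} b (b k)) = 0"
    using basis assms(2)
    by (intro real_vector.independentD[of "b ` {1..d}" "b ` {1..d}"]) auto
  then show ?thesis using inj assms(2) by simp
qed

lemma coord_eqI: "(\<And>k. k \<in> {1..d} \<Longrightarrow> coord k x = coord k y) \<Longrightarrow> x = y"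
  by (metis (mono_tags, lifting) sum.cong sum_coord)

lemma coord_sum:
  assumes "k \<in> {1..d}"
  shows "coord k (\<Sum>j=1..d. c j *\<^sub>R b j) = c k"
proof -
  let ?x = "\<Sum>j=1..d. c j *\<^sub>R b j"
  have "(\<Sum>j=1..d. (coord j ?x - c j) *\<^sub>R b j) = 0"
    using sum_coord[of ?x] by (simp add: scaleR_diff_left sum_subtractf)
  from basis_scalars_zero[OF this assms] show ?thesis by simp
qed

lemma linear_eq_sum_coord:
  assumes "linear f"
  shows "f x = (\<Sum>k=1..d. coord k x *\<^sub>R f (b k))"
  by (subst sum_coord[of x, symmetric])
    (simp add: linear_sum[OF assms] linear_cmul[OF assms] del: sum_coord)

text \<open>Otherwise there are vectors tending to 0 whose coordinates have absolute sum 1; along a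
  subsequence the coordinates converge to a nontrivial relation between the basis vectors.\<close>

lemma coord_bound: "\<exists>C. 0 < C \<and> (\<forall>x. \<forall>k\<in>{1..d}. \<bar>coord k x\<bar> \<le> C * norm x)"
proof (rule ccontr)
  assume neg: "\<not> ?thesis"
  have "\<exists>y. (\<Sum>k=1..d. \<bar>coord k y\<bar>) = 1 \<and> norm y \<le> inverse (real (Suc n))" for n
  proof -
    obtain x k where k: "k \<in> {1..d}" "\<bar>coord k x\<bar> > real (Suc n) * norm x"
      using neg by (metis not_le of_nat_0_less_iff zero_less_Suc)
    define s where "s = (\<Sum>k=1..d. \<bar>coord k x\<bar>)"
    have "\<bar>coord k x\<bar> \<le> s" unfolding s_def using k(1) by (intro member_le_sum) auto
    moreover have "0 \<le> real (Suc n) * norm x" by simp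
    ultimately have s: "s > 0" "real (Suc n) * norm x \<le> s" using k(2) by linarith+
    have "(\<Sum>k=1..d. \<bar>coord k ((1 / s) *\<^sub>R x)\<bar>) = 1"
      using s(1) by (simp add: linear_cmul[OF linear_coord] abs_mult s_def flip: sum_divide_distrib)
    moreover have "norm ((1 / s) *\<^sub>R x) \<le> inverse (real (Suc n))"
      using s by (simp add: field_simps del: of_nat_Suc)
    ultimately show ?thesis by blast
  qed
  then obtain y where y: "\<And>n. (\<Sum>k=1..d. \<bar>coord k (y n)\<bar>) = 1"
    "\<And>n. norm (y n) \<le> inverse (real (Suc n))" by metis
  have "\<bar>coord k (y n)\<bar> \<le> 1" if "k \<in> {1..d}" for n k
    using member_le_sum[of k "{1..d}" "\<lambda>k. \<bar>coord k (y n)\<bar>"] that y(1)[of n] by auto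
  then obtain r l where r: "strict_mono r"
    "\<And>k. k \<in> {1..d} \<Longrightarrow> (\<lambda>n. coord k (y (r n))) \<longlonglongrightarrow> l k"
    using bounded_family_convergent_subsequence
        [OF finite_atLeastAtMost, of 1 d "\<lambda>n k. coord k (y n)" 1] by blast
  have "(\<lambda>n. \<Sum>k=1..d. coord k (y (r n)) *\<^sub>R b k) \<longlonglongrightarrow> (\<Sum>k=1..d. l k *\<^sub>R b k)"
    using r(2) by (intro tendsto_intros) auto
  moreover have "y \<longlonglongrightarrow> 0"
    by (rule tendsto_norm_zero_cancel, rule tendsto_sandwich[OF _ _ tendsto_const LIMSEQ_inverse_real_of_nat])
      (use y(2) in auto)
  then have "(\<lambda>n. y (r n)) \<longlonglongrightarrow> 0"
    using LIMSEQ_subseq_LIMSEQ[OF _ r(1)] by (auto simp: comp_def)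
  ultimately have "(\<Sum>k=1..d. l k *\<^sub>R b k) = 0"
    unfolding sum_coord by (rule LIMSEQ_unique)
  then have "\<And>k. k \<in> {1..d} \<Longrightarrow> l k = 0" using basis_scalars_zero by blast
  moreover have "(\<lambda>n. \<Sum>k=1..d. \<bar>coord k (y (r n))\<bar>) \<longlonglongrightarrow> (\<Sum>k=1..d. \<bar>l k\<bar>)"
    using r(2) by (intro tendsto_sum tendsto_rabs)
  ultimately show False using y(1) by (simp add: LIMSEQ_const_iff)
qed

lemma linear_imp_bounded_linear:
  fixes f :: "'a \<Rightarrow> 'c::real_normed_vector"
  assumes "linear f"
  shows "bounded_linear f"
proof -
  obtain C where C: "\<And>x k. k \<in> {1..d} \<Longrightarrow> \<bar>coord k x\<bar> \<le> C * norm x"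
    using coord_bound by blast
  have "norm (f x) \<le> norm x * (\<Sum>k=1..d. C * norm (f (b k)))" for x
  proof -
    have "norm (f x) \<le> (\<Sum>k=1..d. norm (coord k x *\<^sub>R f (b k)))"
      unfolding linear_eq_sum_coord[OF assms, of x] by (rule norm_sum)
    also have "\<dots> \<le> (\<Sum>k=1..d. (C * norm x) * norm (f (b k)))"
      using C by (auto intro!: sum_mono mult_right_mono)
    also have "\<dots> = norm x * (\<Sum>k=1..d. C * norm (f (b k)))"
      by (simp add: sum_distrib_left mult_ac)
    finally show ?thesis .
  qed
  then show ?thesis
    using assms by (intro bounded_linear_intro) (auto simp: linear_add linear_cmul)
qed

lemma tendsto_linear:
  fixes f :: "'a \<Rightarrow> 'c::real_normed_vector"
  assumes "linear f" "(g \<longlongrightarrow> l) F"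
  shows "((\<lambda>x. f (g x)) \<longlongrightarrow> f l) F"
  by (rule bounded_linear.tendsto[OF linear_imp_bounded_linear]) fact+

text \<open>Expansion in coordinates upgrades convergence on the basis to convergence along moving
  arguments. This serves limits of isometries that are evaluated at moving points.\<close>

lemma tendsto_linear_family:
  fixes L :: "'n \<Rightarrow> 'a \<Rightarrow> 'c::real_normed_vector"
  assumes "\<And>n. linear (L n)" "linear A"
    and "\<And>k. k \<in> {1..d} \<Longrightarrow> ((\<lambda>n. L n (b k)) \<longlongrightarrow> A (b k)) F" "(y \<longlongrightarrow> z) F"
  shows "((\<lambda>n. L n (y n)) \<longlongrightarrow> A z) F"
proof -
  have "((\<lambda>n. \<Sum>k=1..d. coord k (y n) *\<^sub>R L n (b k)) \<longlongrightarrow> (\<Sum>k=1..d. coord k z *\<^sub>R A (b k))) F"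
    by (intro tendsto_sum tendsto_scaleR tendsto_linear[OF linear_coord assms(4)] assms(3))
  moreover have "L n (y n) = (\<Sum>k=1..d. coord k (y n) *\<^sub>R L n (b k))" for n
    by (rule linear_eq_sum_coord[OF assms(1)])
  moreover have "A z = (\<Sum>k=1..d. coord k z *\<^sub>R A (b k))"
    by (rule linear_eq_sum_coord[OF assms(2)])
  ultimately show ?thesis by (simp only:)
qed

text \<open>Linear extension from the basis; it names limits of linear maps that are known only on
  \<open>b\<close>.\<close>

definition lin_of :: "(nat \<Rightarrow> 'c) \<Rightarrow> 'a \<Rightarrow> 'c::real_normed_vector" where
  "lin_of w x = (\<Sum>k=1..d. coord k x *\<^sub>R w k)"

lemma linear_lin_of: "linear (lin_of w)"
  unfolding lin_of_def
  by (intro linearI) (simp_all add: linear_add[OF linear_coord] linear_cmul[OF linear_coord]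
      scaleR_add_left sum.distrib scaleR_sum_right)

lemma coord_basis:
  assumes "k \<in> {1..d}" "j \<in> {1..d}"
  shows "coord k (b j) = (if k = j then 1 else 0)"
proof -
  have "b j = (\<Sum>i=1..d. (if i = j then 1 else 0) *\<^sub>R b i)"
    using assms(2) by (simp add: if_distrib[of "\<lambda>x. x *\<^sub>R _"] cong: if_cong)
  then show ?thesis using coord_sum[OF assms(1), of "\<lambda>i. if i = j then 1 else 0"] by simp
qed

lemma lin_of_basis: "k \<in> {1..d} \<Longrightarrow> lin_of w (b k) = w k"
  by (simp add: lin_of_def coord_basis if_distrib[of "\<lambda>x. x *\<^sub>R _"] cong: if_cong)

lemma bounded_family_convergent_subsequence_vector:
  fixes x :: "nat \<Rightarrow> 'j \<Rightarrow> 'a"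
  assumes "finite J" "\<And>n j. j \<in> J \<Longrightarrow> norm (x n j) \<le> M"
  shows "\<exists>r l. strict_mono r \<and> (\<forall>j\<in>J. (\<lambda>n. x (r n) j) \<longlonglongrightarrow> l j)"
proof -
  obtain C where C: "0 < C" "\<And>x k. k \<in> {1..d} \<Longrightarrow> \<bar>coord k x\<bar> \<le> C * norm x"
    using coord_bound by blast
  have "\<bar>coord (snd i) (x n (fst i))\<bar> \<le> C * M" if "i \<in> J \<times> {1..d}" for n i
  proof -
    have "\<bar>coord (snd i) (x n (fst i))\<bar> \<le> C * norm (x n (fst i))" using C that by auto
    also have "\<dots> \<le> C * M" using C(1) assms(2) that by (intro mult_left_mono) auto
    finally show ?thesis .
  qed
  then obtain r l where r: "strict_mono r"
    "\<And>i. i \<in> J \<times> {1..d} \<Longrightarrow> (\<lambda>n. coord (snd i) (x (r n) (fst i))) \<longlonglongrightarrow> l i"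
    using bounded_family_convergent_subsequence
      [OF finite_cartesian_product[OF assms(1) finite_atLeastAtMost],
        of 1 d "\<lambda>n i. coord (snd i) (x n (fst i))" "C * M"] by blast
  have "(\<lambda>n. \<Sum>k=1..d. coord k (x (r n) j) *\<^sub>R b k) \<longlonglongrightarrow> (\<Sum>k=1..d. l (j, k) *\<^sub>R b k)" if "j \<in> J" for j
    using r(2)[of "(j, _)"] that by (intro tendsto_intros) auto
  then show ?thesis unfolding sum_coord using r(1) by (intro exI[of _ r] exI) auto
qed

text \<open>The basis instantiates the abstract theory of finite dimensional vector spaces. The
  result is needed to invert linear isometries.\<close>

lemma linear_inj_imp_surj:
  assumes "linear (f :: 'a \<Rightarrow> 'a)" "inj f"
  shows "surj f"
proof -
  have "finite_dimensional_vector_space_axioms scaleR (b ` {1..d})"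
    using basis unfolding finite_dimensional_vector_space_axioms_def dependent_raw_def span_raw_def
    by blast
  then have fin: "finite_dimensional_vector_space scaleR (b ` {1..d})"
    by (rule finite_dimensional_vector_space.intro[OF real_vector.vector_space_axioms])
  show ?thesis
    by (rule finite_dimensional_vector_space.linear_inj_imp_surj[OF fin assms(1)[unfolded linear_def] assms(2)])
qed

subsection \<open>Linear differential equations\<close>

text \<open>The solution is \<open>exp (t A) y\<close>, written in coordinates as real power series
  \<open>f k\<close> that are dominated by an exponential series.\<close>

lemma linear_ode_solution:
  fixes A :: "'a \<Rightarrow> 'a"
  assumes A: "linear A"
  shows "\<exists>x. x 0 = y \<and> (\<forall>t. (x has_vector_derivative A (x t)) (at t))"
proof -
  define a where "a = (\<lambda>k n. coord k ((A ^^ n) y) / fact n)"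
  define f where "f = (\<lambda>k t. \<Sum>n. a k n * t ^ n)"
  define x where "x = (\<lambda>t. \<Sum>k=1..d. f k t *\<^sub>R b k)"
  obtain C where C: "0 < C" "\<And>x k. k \<in> {1..d} \<Longrightarrow> \<bar>coord k x\<bar> \<le> C * norm x"
    using coord_bound by blast
  obtain K where K: "\<And>z. norm (A z) \<le> norm z * K" "K \<ge> 0"
    using bounded_linear.nonneg_bounded[OF linear_imp_bounded_linear[OF A]] by blast
  have pow: "norm ((A ^^ n) y) \<le> K ^ n * norm y" for n
  proof (induction n)
    case (Suc n)
    have "norm (A ((A ^^ n) y)) \<le> norm ((A ^^ n) y) * K" by (rule K)
    also have "\<dots> \<le> K ^ n * norm y * K" using Suc K(2) by (rule mult_right_mono)
    finally show ?case by (simp add: mult_ac)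
  qed simp
  have summable: "summable (\<lambda>n. a k n * t ^ n)" if "k \<in> {1..d}" for k t
  proof (rule summable_comparison_test')
    show "summable (\<lambda>n. C * norm y * (inverse (fact n) * (K * \<bar>t\<bar>) ^ n))"
      by (intro summable_mult summable_exp)
    fix n
    have "\<bar>coord k ((A ^^ n) y)\<bar> \<le> C * (K ^ n * norm y)"
      using C(2)[OF that, of "(A ^^ n) y"] mult_left_mono[OF pow[of n], of C] C(1) by linarith
    then have "\<bar>coord k ((A ^^ n) y)\<bar> * (inverse (fact n) * \<bar>t\<bar> ^ n)
        \<le> C * (K ^ n * norm y) * (inverse (fact n) * \<bar>t\<bar> ^ n)"
      by (rule mult_right_mono) simp
    then show "norm (a k n * t ^ n) \<le> C * norm y * (inverse (fact n) * (K * \<bar>t\<bar>) ^ n)"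
      by (simp add: a_def abs_mult power_abs power_mult_distrib divide_inverse mult_ac)
  qed
  \<comment> \<open>The factor \<open>Suc n\<close> in \<open>diffs\<close> cancels against the
    factorial, so differentiating the series amounts to applying \<open>A\<close>.\<close>
  have diffs: "diffs (a k) n = (\<Sum>j=1..d. coord k (A (b j)) * a j n)" for k n
  proof -
    have "diffs (a k) n = coord k (A ((A ^^ n) y)) / fact n"
      by (simp add: diffs_def a_def field_simps del: of_nat_Suc)
    also have "A ((A ^^ n) y) = (\<Sum>j=1..d. coord j ((A ^^ n) y) *\<^sub>R A (b j))"
      by (rule linear_eq_sum_coord[OF A])
    finally show ?thesis
      by (simp add: linear_sum[OF linear_coord] linear_cmul[OF linear_coord] a_def
          sum_divide_distrib mult_ac)
  qed
  have deriv: "(f k has_real_derivative (\<Sum>j=1..d. coord k (A (b j)) * f j t)) (at t)"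
    if "k \<in> {1..d}" for k t
  proof -
    have "(f k has_real_derivative (\<Sum>n. diffs (a k) n * t ^ n)) (at t)"
      unfolding f_def using summable[OF that] by (rule termdiffs_strong_converges_everywhere)
    also have "(\<Sum>n. diffs (a k) n * t ^ n) = (\<Sum>n. \<Sum>j=1..d. coord k (A (b j)) * (a j n * t ^ n))"
      by (simp add: diffs sum_distrib_right mult.assoc)
    also have "\<dots> = (\<Sum>j=1..d. \<Sum>n. coord k (A (b j)) * (a j n * t ^ n))"
      by (rule suminf_sum) (intro summable_mult summable)
    also have "\<dots> = (\<Sum>j=1..d. coord k (A (b j)) * f j t)"
      unfolding f_def by (intro sum.cong refl suminf_mult summable)
    finally show ?thesis .
  qed
  have "(x has_vector_derivative A (x t)) (at t)" for t
  proof -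
    have "(x has_vector_derivative (\<Sum>k=1..d. (\<Sum>j=1..d. coord k (A (b j)) * f j t) *\<^sub>R b k)) (at t)"
      unfolding x_def
      by (intro has_vector_derivative_sum)
        (auto intro!: derivative_eq_intros deriv has_vector_derivative_eq_rhs[OF has_vector_derivative_scaleR])
    also have "(\<Sum>k=1..d. (\<Sum>j=1..d. coord k (A (b j)) * f j t) *\<^sub>R b k)
        = (\<Sum>j=1..d. f j t *\<^sub>R (\<Sum>k=1..d. coord k (A (b j)) *\<^sub>R b k))"
      unfolding scaleR_sum_left scaleR_sum_right by (subst sum.swap) (simp add: mult.commute)
    also have "\<dots> = A (x t)"
      by (simp only: sum_coord) (simp add: x_def linear_sum[OF A] linear_cmul[OF A])
    finally show ?thesis .
  qed
  moreover have "x 0 = y"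
  proof -
    have "x 0 = (\<Sum>k=1..d. coord k y *\<^sub>R b k)" unfolding x_def f_def powser_zero by (simp add: a_def)
    then show ?thesis by (simp only: sum_coord)
  qed
  ultimately show ?thesis by blast
qed

text \<open>This is \<open>exp (t A) y\<close>. A whole trajectory is chosen for each starting
  point; for infinitesimal isometries \<open>flow_unique\<close> shows that there is only
  one.\<close>

definition flow :: "('a \<Rightarrow> 'a) \<Rightarrow> real \<Rightarrow> 'a \<Rightarrow> 'a" where
  "flow A t y = (SOME x. x 0 = y \<and> (\<forall>t. (x has_vector_derivative A (x t)) (at t))) t"

lemma
  assumes "linear A"
  shows flow_0: "flow A 0 y = y"
    and has_vector_derivative_flow: "((\<lambda>t. flow A t y) has_vector_derivative A (flow A t y)) (at t)"
  using someI_ex[OF linear_ode_solution[OF assms, of y]] unfolding flow_def by auto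

end

section \<open>Support functionals\<close>

notation support_functional ("\<phi>")

lemma has_vector_derivative_quotient:
  assumes "(f has_vector_derivative f') (at t)"
  shows "((\<lambda>h. (f (t + h) - f t) /\<^sub>R h) \<longlongrightarrow> f') (at 0)"
proof -
  have "((\<lambda>h. norm ((f (t + h) - f t) /\<^sub>R h - f')) \<longlongrightarrow> 0) (at 0)"
  proof (rule Lim_transform_eventually)
    show "((\<lambda>h. norm (f (t + h) - f t - h *\<^sub>R f') / norm h) \<longlongrightarrow> 0) (at 0)"
      using assms unfolding has_vector_derivative_def has_derivative_at by blast
    have "norm (f (t + h) - f t - h *\<^sub>R f') / norm h = norm ((f (t + h) - f t) /\<^sub>R h - f')"
      if "h \<noteq> 0" for h
    proof -
      have "(f (t + h) - f t) /\<^sub>R h - f' = (f (t + h) - f t - h *\<^sub>R f') /\<^sub>R h"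
        using that by (simp add: scaleR_diff_right)
      then show ?thesis by (simp add: divide_inverse_commute)
    qed
    then show "\<forall>\<^sub>F h in at 0. norm (f (t + h) - f t - h *\<^sub>R f') / norm h
        = norm ((f (t + h) - f t) /\<^sub>R h - f')"
      by (simp add: eventually_at_filter)
  qed
  then show ?thesis by (simp add: tendsto_norm_zero_iff LIM_zero_iff)
qed

locale smooth_strictly_convex = finite_basis b d for b :: "nat \<Rightarrow> 'a::real_normed_vector" and d +
  assumes smooth: "smooth_space TYPE('a)"
    and strictly_convex: "strictly_convex_space TYPE('a)"
begin

text \<open>Scaling to the unit ball gives the pointwise bound from the supremum, and
  \<open>x\<close> divided by its norm attains it. In this form the condition passes to
  limits.\<close>

lemma supports_iff:
  fixes x :: 'a
  shows "supports f x \<longleftrightarrow>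
    linear f \<and> f x = (norm x)\<^sup>2 \<and> (\<forall>y. \<bar>f y\<bar> \<le> norm x * norm y)"
proof -
  have bdd: "bdd_above ((\<lambda>y. \<bar>f y\<bar>) ` {y. norm y \<le> 1})" if f: "linear f"
  proof -
    obtain K where K: "\<And>y. norm (f y) \<le> norm y * K" "K \<ge> 0"
      using bounded_linear.nonneg_bounded[OF linear_imp_bounded_linear[OF f]] by blast
    have "\<bar>f y\<bar> \<le> K" if "norm y \<le> 1" for y
      using K(1)[of y] mult_right_mono[OF that K(2)] by simp
    then show ?thesis by (intro bdd_aboveI2[where M = K]) auto
  qed
  show ?thesis
  proof
    assume s: "supports f x"
    then have f: "linear f" by (simp add: supports_def)
    have "\<bar>f y\<bar> \<le> norm x * norm y" for y
    proof (cases "y = 0")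
      case False
      have "\<bar>f (y /\<^sub>R norm y)\<bar> \<le> norm x"
        using s cSUP_upper[OF _ bdd[OF f], of "y /\<^sub>R norm y"] False by (simp add: supports_def)
      then show ?thesis using False by (simp add: linear_cmul[OF f] abs_mult field_simps)
    qed (simp add: linear_0[OF f])
    then show "linear f \<and> f x = (norm x)\<^sup>2 \<and> (\<forall>y. \<bar>f y\<bar> \<le> norm x * norm y)"
      using s by (simp add: supports_def)
  next
    assume s: "linear f \<and> f x = (norm x)\<^sup>2 \<and> (\<forall>y. \<bar>f y\<bar> \<le> norm x * norm y)"
    then have f: "linear f" by blast
    have "(SUP y\<in>{y. norm y \<le> 1}. \<bar>f y\<bar>) \<le> norm x"
    proof (rule cSUP_least)
      show "{y::'a. norm y \<le> 1} \<noteq> {}" by (auto intro: exI[of _ 0])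
      fix y :: 'a assume "y \<in> {y. norm y \<le> 1}"
      then show "\<bar>f y\<bar> \<le> norm x"
        using s mult_left_mono[of "norm y" 1 "norm x"] by (force intro: order_trans)
    qed
    moreover have "norm x \<le> (SUP y\<in>{y. norm y \<le> 1}. \<bar>f y\<bar>)"
    proof -
      have "\<bar>f (x /\<^sub>R norm x)\<bar> \<le> (SUP y\<in>{y. norm y \<le> 1}. \<bar>f y\<bar>)"
        by (rule cSUP_upper[OF _ bdd[OF f]]) (cases "x = 0"; simp)
      moreover have "\<bar>f (x /\<^sub>R norm x)\<bar> = norm x"
        using s by (cases "x = 0") (simp_all add: linear_cmul[OF f] power2_eq_square flip: mult.assoc)
      ultimately show ?thesis by simp
    qed
    ultimately show "supports f x" using s by (auto simp: supports_def)
  qed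
qed

text \<open>At 0 the bound in \<open>supports_iff\<close> leaves only the zero functional; elsewhere
  the space is smooth. Hence \<open>\<phi>\<close> is characterised at every point.\<close>

lemma ex1_supports: "\<exists>!f. supports f (x::'a)"
proof (cases "x = 0")
  case True
  then show ?thesis
    by (intro ex1I[of _ "\<lambda>_. 0"]) (auto simp: supports_iff fun_eq_iff linear_iff)
next
  case False
  then show ?thesis using smooth by (simp add: smooth_space_def smooth_point_def)
qed

lemma supports_phi: "supports (\<phi> x) (x::'a)"
  unfolding support_functional_def by (rule theI'[OF ex1_supports])

lemma
  fixes x :: 'a
  shows linear_phi: "linear (\<phi> x)"
    and phi_self: "\<phi> x x = (norm x)\<^sup>2"
    and abs_phi_le: "\<bar>\<phi> x y\<bar> \<le> norm x * norm y"
  using supports_phi[of x] unfolding supports_iff by blast+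

lemma phi_le: "\<phi> x y \<le> norm x * norm (y::'a)"
  using abs_phi_le[of x y] by linarith

lemma phi_eqI:
  fixes x :: 'a
  assumes "linear f" "f x = (norm x)\<^sup>2" "\<And>y. \<bar>f y\<bar> \<le> norm x * norm y"
  shows "\<phi> x = f"
  using ex1_supports[of x] supports_phi[of x] assms unfolding supports_iff by blast

lemma phi_minus: "\<phi> (- x) y = - \<phi> x (y::'a)"
proof -
  have "\<phi> (- x) = (\<lambda>y. - \<phi> x y)"
    by (intro phi_eqI linearI)
      (auto simp: linear_add[OF linear_phi] linear_cmul[OF linear_phi] linear_neg[OF linear_phi]
        phi_self abs_phi_le)
  then show ?thesis by simp
qed

text \<open>Every accumulation point of support functionals of points tending to \<open>x\<close> supports \<open>x\<close>.\<close>

lemma phi_sequentially: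
  fixes x :: 'a
  assumes x: "X \<longlonglongrightarrow> x" and y: "Y \<longlonglongrightarrow> y"
  shows "(\<lambda>n. \<phi> (X n) (Y n)) \<longlonglongrightarrow> \<phi> x y"
proof (rule ccontr)
  assume "\<not> ?thesis"
  then obtain e where e: "e > 0" "\<exists>\<^sub>F n in sequentially. \<not> dist (\<phi> (X n) (Y n)) (\<phi> x y) < e"
    unfolding tendsto_iff frequently_def by auto
  then obtain r :: "nat \<Rightarrow> nat" where r: "strict_mono r" "\<And>n. \<not> dist (\<phi> (X (r n)) (Y (r n))) (\<phi> x y) < e"
    using infinite_enumerate[of "{n. \<not> dist (\<phi> (X n) (Y n)) (\<phi> x y) < e}"]
    unfolding frequently_cofinite[symmetric] cofinite_eq_sequentially by auto
  obtain M where M: "\<And>n. norm (X n) \<le> M"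
    using x by (meson Bseq_eq_bounded convergentI convergent_imp_Bseq Bseq_def)
  have "\<bar>\<phi> (X (r n)) (b k)\<bar> \<le> M * (\<Sum>k=1..d. norm (b k))" if "k \<in> {1..d}" for n k
  proof -
    have "\<bar>\<phi> (X (r n)) (b k)\<bar> \<le> norm (X (r n)) * norm (b k)" by (rule abs_phi_le)
    also have "\<dots> \<le> M * (\<Sum>k=1..d. norm (b k))"
      using that M norm_ge_zero order_trans[OF norm_ge_zero M] by (intro mult_mono member_le_sum) auto
    finally show ?thesis .
  qed
  then obtain s l where s: "strict_mono s"
    "\<And>k. k \<in> {1..d} \<Longrightarrow> (\<lambda>n. \<phi> (X (r (s n))) (b k)) \<longlonglongrightarrow> l k"
    using bounded_family_convergent_subsequence[OF finite_atLeastAtMost, of 1 d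
      "\<lambda>n k. \<phi> (X (r n)) (b k)"] by blast
  have lim: "(\<lambda>n. \<phi> (X (r (s n))) (Z n)) \<longlonglongrightarrow> lin_of l z" if "Z \<longlonglongrightarrow> z" for Z z
    using s(2) by (intro tendsto_linear_family[OF linear_phi linear_lin_of _ that]) (simp add: lin_of_basis)
  have X: "(\<lambda>n. X (r (s n))) \<longlonglongrightarrow> x" and Y: "(\<lambda>n. Y (r (s n))) \<longlonglongrightarrow> y"
    using LIMSEQ_subseq_LIMSEQ[OF x strict_mono_o[OF r(1) s(1)]]
      LIMSEQ_subseq_LIMSEQ[OF y strict_mono_o[OF r(1) s(1)]] by (simp_all add: comp_def)
  have "\<phi> x = lin_of l"
  proof (rule phi_eqI[OF linear_lin_of])
    have "(\<lambda>n. (norm (X (r (s n))))\<^sup>2) \<longlonglongrightarrow> lin_of l x" using lim[OF X] by (simp add: phi_self)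
    moreover have "(\<lambda>n. (norm (X (r (s n))))\<^sup>2) \<longlonglongrightarrow> (norm x)\<^sup>2" using X by (intro tendsto_intros)
    ultimately show "lin_of l x = (norm x)\<^sup>2" by (rule LIMSEQ_unique)
    fix y
    show "\<bar>lin_of l y\<bar> \<le> norm x * norm y"
      using LIMSEQ_le[OF tendsto_rabs[OF lim[OF tendsto_const]] tendsto_mult_right[OF tendsto_norm[OF X]]]
        abs_phi_le by blast
  qed
  then have "(\<lambda>n. \<phi> (X (r (s n))) (Y (r (s n)))) \<longlonglongrightarrow> \<phi> x y" using lim[OF Y] by simp
  then have "\<forall>\<^sub>F n in sequentially. dist (\<phi> (X (r (s n))) (Y (r (s n)))) (\<phi> x y) < e"
    using e(1) by (rule tendstoD)
  then show False using r(2) by simp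
qed

text \<open>The product space is metric, so sequential continuity in both arguments jointly is
  continuity.\<close>

lemma tendsto_phi:
  assumes "(f \<longlongrightarrow> (x::'a)) F" "(g \<longlongrightarrow> y) F"
  shows "((\<lambda>t. \<phi> (f t) (g t)) \<longlongrightarrow> \<phi> x y) F"
proof -
  have "isCont (\<lambda>p. \<phi> (fst p) (snd p)) (x, y)"
    unfolding continuous_at_sequentially comp_def
    by (auto intro!: phi_sequentially dest: tendsto_fst tendsto_snd)
  from isCont_tendsto_compose[OF this tendsto_Pair[OF assms]] show ?thesis by simp
qed

section \<open>Support functionals as subgradients of the squared norm\<close>

text \<open>This follows from the bound on \<open>\<phi> x y\<close> and
  \<open>2 a b \<le> a^2 + b^2\<close>. It makes \<open>2 \<phi> x\<close> a subgradient of the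
  squared norm and replaces any differentiation of the norm.\<close>

lemma phi_subgradient: "2 * \<phi> x (y - x) \<le> (norm y)\<^sup>2 - (norm (x::'a))\<^sup>2"
proof -
  have "\<phi> x (y - x) \<le> norm x * norm y - (norm x)\<^sup>2"
    using phi_le[of x y] by (simp add: linear_diff[OF linear_phi] phi_self)
  moreover have "2 * norm x * norm y \<le> (norm x)\<^sup>2 + (norm y)\<^sup>2" by (rule sum_squares_bound)
  ultimately show ?thesis by simp
qed

text \<open>The points \<open>X t\<close> and \<open>X t + c t Y t\<close> have equal norms, so the
  subgradient inequalities at both give the values of the two functionals at \<open>Y t\<close>
  opposite signs. Both values tend to \<open>\<phi> x y\<close>, whose square is therefore at most
  0.\<close>

lemma phi_limit_zero:
  fixes x :: 'a
  assumes "(X \<longlongrightarrow> x) F" "(Y \<longlongrightarrow> y) F" "\<forall>\<^sub>F t in F. norm (X t + c t *\<^sub>R Y t) = norm (X t)"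
    and "\<forall>\<^sub>F t in F. c t \<noteq> 0" "(c \<longlongrightarrow> 0) F" "F \<noteq> bot"
  shows "\<phi> x y = 0"
proof -
  let ?a = "\<lambda>t. \<phi> (X t) (Y t)" and ?b = "\<lambda>t. \<phi> (X t + c t *\<^sub>R Y t) (Y t)"
  have a: "(?a \<longlongrightarrow> \<phi> x y) F" using assms by (intro tendsto_phi)
  have b: "(?b \<longlongrightarrow> \<phi> (x + 0 *\<^sub>R y) y) F" using assms by (intro tendsto_phi tendsto_intros)
  have "\<forall>\<^sub>F t in F. ?a t * ?b t \<le> 0"
    using assms(3,4)
  proof eventually_elim
    case (elim t)
    have "c t * ?a t \<le> 0"
      using phi_subgradient[of "X t" "X t + c t *\<^sub>R Y t"] elim by (simp add: linear_cmul[OF linear_phi])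
    moreover have "0 \<le> c t * ?b t"
      using phi_subgradient[of "X t + c t *\<^sub>R Y t" "X t"] elim
      by (simp add: linear_cmul[OF linear_phi] linear_neg[OF linear_phi])
    ultimately show ?case using elim(2)
      by (auto simp: mult_le_0_iff zero_le_mult_iff)
  qed
  then have "\<phi> x y * \<phi> x y \<le> 0"
    using tendsto_upperbound[OF tendsto_mult[OF a b]] assms(6) by simp
  then show ?thesis by (metis mult_eq_0_iff not_real_square_gt_zero not_le)
qed

text \<open>The subgradient inequalities at \<open>f t\<close> and \<open>f (t + h)\<close> enclose
  the difference quotient between the doubled values of the two functionals at \<open>q h\<close>,
  both of which tend to \<open>2 \<phi> (f t) f' = 0\<close>.\<close>

lemma norm_square_derivative_zero:
  fixes f :: "real \<Rightarrow> 'a"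
  assumes f: "(f has_vector_derivative f') (at t)" and zero: "\<phi> (f t) f' = 0"
  shows "((\<lambda>t. (norm (f t))\<^sup>2) has_real_derivative 0) (at t)"
proof -
  define q where "q = (\<lambda>h. (f (t + h) - f t) /\<^sub>R h)"
  have q: "(q \<longlongrightarrow> f') (at 0)" unfolding q_def by (rule has_vector_derivative_quotient[OF f])
  have c: "((\<lambda>h. f (t + h)) \<longlongrightarrow> f t) (at 0)"
    using has_vector_derivative_continuous[OF f] by (simp add: isCont_iff)
  let ?D = "\<lambda>h. ((norm (f (t + h)))\<^sup>2 - (norm (f t))\<^sup>2) / h"
  have bnd: "\<bar>?D h\<bar> \<le> 2 * \<bar>\<phi> (f t) (q h)\<bar> + 2 * \<bar>\<phi> (f (t + h)) (q h)\<bar>" if "h \<noteq> 0" for h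
  proof -
    have q: "f (t + h) - f t = h *\<^sub>R q h" "f t - f (t + h) = - (h *\<^sub>R q h)"
      using that by (simp_all add: q_def)
    have 1: "2 * h * \<phi> (f t) (q h) \<le> (norm (f (t + h)))\<^sup>2 - (norm (f t))\<^sup>2"
      using phi_subgradient[of "f t" "f (t + h)"] unfolding q by (simp add: linear_cmul[OF linear_phi])
    have 2: "(norm (f (t + h)))\<^sup>2 - (norm (f t))\<^sup>2 \<le> 2 * h * \<phi> (f (t + h)) (q h)"
      using phi_subgradient[of "f (t + h)" "f t"] unfolding q
      by (simp add: linear_cmul[OF linear_phi] linear_neg[OF linear_phi])
    have "\<bar>(norm (f (t + h)))\<^sup>2 - (norm (f t))\<^sup>2\<bar> \<le> \<bar>2 * h * \<phi> (f t) (q h)\<bar> + \<bar>2 * h * \<phi> (f (t + h)) (q h)\<bar>"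
      using 1 2 by linarith
    also have "\<dots> = \<bar>h\<bar> * (2 * \<bar>\<phi> (f t) (q h)\<bar> + 2 * \<bar>\<phi> (f (t + h)) (q h)\<bar>)"
      by (simp add: abs_mult algebra_simps)
    finally show ?thesis using that by (simp add: abs_divide divide_le_eq mult.commute)
  qed
  have "((\<lambda>h. 2 * \<bar>\<phi> (f t) (q h)\<bar> + 2 * \<bar>\<phi> (f (t + h)) (q h)\<bar>) \<longlongrightarrow> 2 * \<bar>\<phi> (f t) f'\<bar> + 2 * \<bar>\<phi> (f t) f'\<bar>) (at 0)"
    using q c by (intro tendsto_intros tendsto_phi)
  then have lim: "((\<lambda>h. 2 * \<bar>\<phi> (f t) (q h)\<bar> + 2 * \<bar>\<phi> (f (t + h)) (q h)\<bar>) \<longlongrightarrow> 0) (at 0)"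
    by (simp add: zero)
  have "\<forall>\<^sub>F h in at 0. norm (?D h) \<le> 2 * \<bar>\<phi> (f t) (q h)\<bar> + 2 * \<bar>\<phi> (f (t + h)) (q h)\<bar>"
    unfolding eventually_at_filter real_norm_def using bnd by (intro always_eventually) blast
  then have "(?D \<longlongrightarrow> 0) (at 0)"
    using lim by (rule Lim_null_comparison)
  then show ?thesis by (simp add: DERIV_def)
qed

section \<open>Consequences of strict convexity\<close>

lemma strictly_convexD:
  fixes x y :: 'a
  assumes "x \<noteq> 0" "y \<noteq> 0" "\<And>c. x \<noteq> c *\<^sub>R y"
  shows "norm (x + y) < norm x + norm y"
  using strictly_convex assms unfolding strictly_convex_space_def by blast

text \<open>Distinct collinear vectors of equal norm are opposite and add up to 0; all other pairs
  are covered by strict convexity.\<close>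

lemma norm_add_less_of_equal_norms:
  fixes x y :: 'a
  assumes "norm x = norm y" "x \<noteq> y"
  shows "norm (x + y) < 2 * norm x"
proof (cases "\<exists>c. x = c *\<^sub>R y")
  case True
  then obtain c where c: "x = c *\<^sub>R y" by blast
  have y: "y \<noteq> 0" using assms c by auto
  then have "\<bar>c\<bar> = 1" using assms(1) c by simp
  then have "c = -1" using assms(2) c by (auto simp: abs_if split: if_splits)
  then show ?thesis using c y by simp
next
  case False
  have "x \<noteq> 0" "y \<noteq> 0" using assms by auto
  then show ?thesis using strictly_convexD[of x y] False assms(1) by auto
qed

text \<open>If \<open>\<phi> y\<close> annihilates \<open>z\<close>, then \<open>y\<close> has the least norm on the line through \<open>y\<close> in
  direction \<open>z\<close>, and by strict convexity the minimiser is unique.\<close>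

lemma phi_zero_unique_on_line:
  fixes y z :: 'a
  assumes "\<phi> y z = 0" "\<phi> (y + s *\<^sub>R z) z = 0" "z \<noteq> 0"
  shows "s = 0"
proof (rule ccontr)
  assume s: "s \<noteq> 0"
  have min: "norm u \<le> norm (u + t *\<^sub>R z)" if "\<phi> u z = 0" for u t
  proof -
    have "(norm u)\<^sup>2 \<le> (norm (u + t *\<^sub>R z))\<^sup>2"
      using phi_subgradient[of u "u + t *\<^sub>R z"] that by (simp add: linear_cmul[OF linear_phi])
    then show ?thesis by (rule power2_le_imp_le) simp
  qed
  have "norm y = norm (y + s *\<^sub>R z)"
    using min[OF assms(1), of s] min[OF assms(2), of "- s"] by simp
  then have "norm (y + (y + s *\<^sub>R z)) < 2 * norm y"
    using s assms(3) by (intro norm_add_less_of_equal_norms) auto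
  moreover have "y + (y + s *\<^sub>R z) = 2 *\<^sub>R (y + (s / 2) *\<^sub>R z)" by (simp add: scaleR_add_right scaleR_2)
  ultimately have "norm (y + (s / 2) *\<^sub>R z) < norm y" by simp
  then show False using min[OF assms(1), of "s / 2"] by simp
qed

subsection \<open>Isometries\<close>

text \<open>If \<open>u\<close> and \<open>v\<close> differed, their midpoint would be strictly
  closer to both \<open>x\<close> and \<open>y\<close> than they are, against the triangle
  inequality for \<open>x\<close> and \<open>y\<close>.\<close>

lemma point_on_segment_unique:
  fixes x y :: 'a
  assumes "dist u x = dist v x" "dist u y = dist v y" "dist x y = dist u x + dist u y"
  shows "u = v"
proof (rule ccontr)
  assume "u \<noteq> v"
  have 1: "norm ((u - x) + (v - x)) < 2 * norm (u - x)"
    using assms \<open>u \<noteq> v\<close> by (intro norm_add_less_of_equal_norms) (auto simp: dist_norm)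
  have 2: "norm ((u - y) + (v - y)) < 2 * norm (u - y)"
    using assms \<open>u \<noteq> v\<close> by (intro norm_add_less_of_equal_norms) (auto simp: dist_norm)
  have "2 *\<^sub>R (y - x) = ((u - x) + (v - x)) - ((u - y) + (v - y))" by (simp add: scaleR_2)
  then have "2 * norm (y - x) \<le> norm ((u - x) + (v - x)) + norm ((u - y) + (v - y))"
    using norm_triangle_ineq4[of "(u - x) + (v - x)" "(u - y) + (v - y)"]
    by (metis norm_scaleR abs_numeral)
  then show False using 1 2 assms(3) by (simp add: dist_norm norm_minus_commute)
qed

text \<open>By \<open>point_on_segment_unique\<close> a point of a segment is determined by its
  distances to the ends, so \<open>T\<close> preserves segments together with their parameter. For
  \<open>T - T 0\<close> this is homogeneity with factors in [0,1]; factors above 1 follow by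
  inverting, additivity by midpoints, and negative factors by additivity.\<close>

lemma isometry_affine:
  fixes T :: "'a \<Rightarrow> 'a"
  assumes T: "isometry_map T"
  obtains L c where "linear L" "\<And>x. norm (L x) = norm x" "\<And>x. T x = L x + c"
proof -
  define L where "L = (\<lambda>x. T x - T 0)"
  have dist: "dist (T x) (T y) = dist x y" for x y using T by (simp add: isometry_map_def)
  have seg: "T (x + t *\<^sub>R (y - x)) = T x + t *\<^sub>R (T y - T x)" if t: "0 \<le> t" "t \<le> 1" for x y t
  proof -
    have 1: "dist (z + t *\<^sub>R (w - z)) z = t * dist w z" "dist (z + t *\<^sub>R (w - z)) w = (1 - t) * dist w z"
      for w z :: 'a
    proof -
      show "dist (z + t *\<^sub>R (w - z)) z = t * dist w z" using t by (simp add: dist_norm)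
      have "z + t *\<^sub>R (w - z) - w = (1 - t) *\<^sub>R (z - w)" by (simp add: algebra_simps)
      then show "dist (z + t *\<^sub>R (w - z)) w = (1 - t) * dist w z"
        using t by (simp add: dist_norm norm_minus_commute)
    qed
    show ?thesis
      by (rule point_on_segment_unique[of _ "T x" _ "T y"])
        (simp_all only: dist 1, simp add: dist_commute algebra_simps)
  qed
  have L0: "L 0 = 0" by (simp add: L_def)
  have small: "L (t *\<^sub>R x) = t *\<^sub>R L x" if "0 \<le> t" "t \<le> 1" for t x
    using seg[OF that, of 0 x] by (simp add: L_def)
  have pos: "L (t *\<^sub>R x) = t *\<^sub>R L x" if "0 \<le> t" for t x
  proof (cases "t \<le> 1")
    case False
    have "L x = (1 / t) *\<^sub>R L (t *\<^sub>R x)" using small[of "1 / t" "t *\<^sub>R x"] False by simp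
    then show ?thesis using False by simp
  qed (use small that in simp)
  have add: "L (x + y) = L x + L y" for x y
  proof -
    have half: "u + (1/2) *\<^sub>R (v - u) = (1/2) *\<^sub>R (u + v)" for u v :: 'a
      by (rule scaleR_left_imp_eq[of 2]) (simp_all add: scaleR_add_right scaleR_2)
    have "L ((1/2) *\<^sub>R (x + y)) = T x + (1/2) *\<^sub>R (T y - T x) - T 0"
      using seg[of "1/2" x y] by (simp add: half L_def)
    also have "\<dots> = L x + (1/2) *\<^sub>R (L y - L x)" by (simp add: L_def)
    finally have "L ((1/2) *\<^sub>R (x + y)) = (1/2) *\<^sub>R (L x + L y)" unfolding half .
    then have "(1/2) *\<^sub>R L (x + y) = (1/2) *\<^sub>R (L x + L y)" using pos[of "1/2" "x + y"] by simp
    then show ?thesis by simp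
  qed
  have neg: "L (- x) = - L x" for x using add[of x "- x"] L0 by (simp add: eq_neg_iff_add_eq_0 add.commute)
  have "linear L"
  proof (rule linearI)
    fix t x show "L (t *\<^sub>R x) = t *\<^sub>R L x"
      using pos[of t x] pos[of "- t" x] neg[of "t *\<^sub>R x"] by (cases "0 \<le> t") auto
  qed (rule add)
  moreover have "norm (L x) = norm x" for x using dist[of x 0] by (simp add: L_def dist_norm)
  moreover have "T x = L x + T 0" for x by (simp add: L_def)
  ultimately show ?thesis using that by blast
qed

lemma isometry_mapI:
  fixes T :: "'a \<Rightarrow> 'a"
  assumes "linear L" "\<And>x. norm (L x) = norm x" "\<And>x. T x = L x + c"
  shows "isometry_map T"
  using assms(2)[of "_ - _"] by (simp add: isometry_map_def dist_norm assms(3) linear_diff[OF assms(1)])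

lemma linear_isometry_inverse:
  fixes L :: "'a \<Rightarrow> 'a"
  assumes L: "linear L" "\<And>x. norm (L x) = norm x"
  shows "\<exists>K. linear K \<and> (\<forall>x. norm (K x) = norm x) \<and> (\<forall>x. K (L x) = x)"
proof -
  have "inj L"
  proof (rule injI)
    fix x y assume "L x = L y"
    then show "x = y" using L(2)[of "x - y"] by (simp add: linear_diff[OF L(1)])
  qed
  then have bij: "bij L" using linear_inj_imp_surj[OF L(1)] by (simp add: bij_def)
  define K where "K = inv L"
  have K: "K (L x) = x" "L (K x) = x" for x
    using bij by (simp_all add: K_def bij_is_inj bij_is_surj surj_f_inv_f)
  have "linear K"
  proof (rule linearI)
    show "K (x + y) = K x + K y" for x y using K linear_add[OF L(1), of "K x" "K y"] by metis
    show "K (t *\<^sub>R x) = t *\<^sub>R K x" for t x using K linear_cmul[OF L(1), of t "K x"] by metis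
  qed
  moreover have "norm (K x) = norm x" for x using L(2)[of "K x"] K by simp
  ultimately show ?thesis using K by blast
qed

section \<open>Infinitesimal isometries\<close>

text \<open>The Lie algebra of the group of linear isometries: \<open>\<phi> x (A x)\<close> is half the derivative of
  the squared norm at \<open>x\<close> in direction \<open>A x\<close>.\<close>

definition killing :: "('a \<Rightarrow> 'a) set" where
  "killing = {A. linear A \<and> (\<forall>x. \<phi> x (A x) = 0)}"

lemma killing_linear: "A \<in> killing \<Longrightarrow> linear A"
  by (simp add: killing_def)

lemma killing_phi: "A \<in> killing \<Longrightarrow> \<phi> x (A x) = 0"
  by (simp add: killing_def)

lemma killing_zero: "(\<lambda>_. 0) \<in> killing"
  by (simp add: killing_def linear_iff linear_0[OF linear_phi])

lemma killing_sum:
  assumes "\<And>j. j \<in> J \<Longrightarrow> A j \<in> killing"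
  shows "(\<lambda>x. \<Sum>j\<in>J. c j *\<^sub>R A j x) \<in> killing"
proof -
  have "linear (\<lambda>x. \<Sum>j\<in>J. c j *\<^sub>R A j x)"
    using assms by (intro linear_compose_sum ballI linear_compose_scale_right) (simp add: killing_def)
  then show ?thesis
    using assms by (simp add: killing_def linear_sum[OF linear_phi] linear_cmul[OF linear_phi])
qed

lemma killing_minus: "A \<in> killing \<Longrightarrow> (\<lambda>x. - A x) \<in> killing"
  using killing_sum[of "{()}" "\<lambda>_. A" "\<lambda>_. -1"] by simp

section \<open>Flows of infinitesimal isometries\<close>

lemma solution_norm_const:
  assumes A: "A \<in> killing" and x: "\<And>t. (x has_vector_derivative A (x t)) (at t)"
  shows "norm (x t) = norm (x s)"
proof -
  have "(norm (x t))\<^sup>2 = (norm (x s))\<^sup>2"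
    using DERIV_isconst_all[of "\<lambda>t. (norm (x t))\<^sup>2"] norm_square_derivative_zero[OF x]
      killing_phi[OF A] by blast
  then show ?thesis by (simp add: power2_eq_iff_nonneg)
qed

text \<open>The difference of two solutions is a solution starting at 0, and its norm is
  constant.\<close>

lemma flow_unique:
  assumes A: "A \<in> killing" and x: "\<And>t. (x has_vector_derivative A (x t)) (at t)"
  shows "x t = flow A t (x 0)"
proof -
  define z where "z = (\<lambda>t. x t - flow A t (x 0))"
  note lin = killing_linear[OF A]
  have "(z has_vector_derivative A (z t)) (at t)" for t
    unfolding z_def linear_diff[OF lin]
    by (intro has_vector_derivative_diff x has_vector_derivative_flow lin)
  from solution_norm_const[OF A this, of t 0] show ?thesis by (simp add: z_def flow_0[OF lin])
qed

lemma norm_flow: "A \<in> killing \<Longrightarrow> norm (flow A t y) = norm y"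
  using solution_norm_const[where x = "\<lambda>t. flow A t y" and t = t and s = 0]
  by (simp add: killing_linear flow_0 has_vector_derivative_flow)

lemma linear_flow:
  assumes A: "A \<in> killing"
  shows "linear (flow A t)"
proof (rule linearI)
  note lin = killing_linear[OF A]
  fix x y c
  have "((\<lambda>t. flow A t x + flow A t y) has_vector_derivative A (flow A t x + flow A t y)) (at t)" for t
    unfolding linear_add[OF lin] by (intro has_vector_derivative_add has_vector_derivative_flow lin)
  from flow_unique[OF A this, of t] show "flow A t (x + y) = flow A t x + flow A t y"
    by (simp add: flow_0[OF lin])
  have "((\<lambda>t. c *\<^sub>R flow A t x) has_vector_derivative A (c *\<^sub>R flow A t x)) (at t)" for t
    unfolding linear_cmul[OF lin]
    by (rule bounded_linear.has_vector_derivative[OF bounded_linear_scaleR_right has_vector_derivative_flow[OF lin]])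
  from flow_unique[OF A this, of t] show "flow A t (c *\<^sub>R x) = c *\<^sub>R flow A t x"
    by (simp add: flow_0[OF lin])
qed

text \<open>As a function of \<open>s\<close>, \<open>flow A (s + t) y\<close> is the trajectory
  starting at \<open>flow A t y\<close>; evaluate it at \<open>s = - t\<close>.\<close>

lemma flow_inverse:
  assumes A: "A \<in> killing"
  shows "flow A (- t) (flow A t y) = y"
proof -
  note lin = killing_linear[OF A]
  have "((\<lambda>s. flow A (s + t) y) has_vector_derivative A (flow A (s + t) y)) (at s)" for s
  proof -
    have "((\<lambda>s. s + t) has_vector_derivative 1) (at s)" by (auto intro!: derivative_eq_intros)
    from vector_diff_chain_at[OF this has_vector_derivative_flow[OF lin]]
    show ?thesis by (simp add: comp_def)
  qed
  from flow_unique[OF A this, of "- t"] show ?thesis by (simp add: flow_0[OF lin])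
qed

lemma flow_fixed:
  assumes A: "A \<in> killing" and "A y = 0"
  shows "flow A t y = y"
  using flow_unique[OF A, of "\<lambda>_. y" t] assms(2) by simp

section \<open>Limits of linear isometries near the identity\<close>

text \<open>Adding \<open>s n\<close> times the quotient to \<open>x\<close> gives
  \<open>L n x\<close>, which has the norm of \<open>x\<close>, so \<open>phi_limit_zero\<close>
  applies to the limit.\<close>

lemma killing_limit:
  assumes L: "\<And>n. linear (L n)" "\<And>n x. norm (L n x) = norm x"
    and s: "\<forall>\<^sub>F n in sequentially. s n \<noteq> 0" "s \<longlonglongrightarrow> 0"
    and lim: "\<And>k. k \<in> {1..d} \<Longrightarrow> (\<lambda>n. (L n (b k) - b k) /\<^sub>R s n) \<longlonglongrightarrow> w k"
  shows "lin_of w \<in> killing"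
    and "y \<longlonglongrightarrow> x \<Longrightarrow> (\<lambda>n. (L n (y n) - y n) /\<^sub>R s n) \<longlonglongrightarrow> lin_of w x"
proof -
  have lin: "linear (\<lambda>x. (L n x - x) /\<^sub>R s n)" for n
    by (intro linearI) (simp_all add: linear_add[OF L(1)] linear_cmul[OF L(1)] algebra_simps)
  show *: "(\<lambda>n. (L n (y n) - y n) /\<^sub>R s n) \<longlonglongrightarrow> lin_of w x" if "y \<longlonglongrightarrow> x" for y x
    using lim by (intro tendsto_linear_family[OF lin linear_lin_of _ that]) (simp add: lin_of_basis)
  have "\<phi> x (lin_of w x) = 0" for x
  proof (rule phi_limit_zero[OF tendsto_const *[OF tendsto_const] _ s])
    show "\<forall>\<^sub>F n in sequentially. norm (x + s n *\<^sub>R ((L n x - x) /\<^sub>R s n)) = norm x"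
      using s(1) by eventually_elim (simp add: L(2))
  qed simp
  then show "lin_of w \<in> killing" by (simp add: killing_def linear_lin_of)
qed

text \<open>The isometries \<open>L n\<close> need not tend to the identity, nor do so at rate \<open>\<tau> n\<close>, because they
  are determined only up to isometries fixing all points \<open>q v\<close>. Replace them by competitors whose
  distance to the identity is minimal up to \<open>\<tau> n\<close>. Should this distance \<open>s n\<close> exceed the order of
  \<open>\<tau> n\<close>, then \<open>(L n - id) / s n\<close> accumulates at an infinitesimal isometry \<open>B\<close> that annihilates
  all \<open>q v\<close>, and composing \<open>L n\<close> with the flow of \<open>B\<close> at time \<open>- s n\<close> gives better competitors.\<close>

lemma killing_of_isometries:
  fixes \<eta> :: "nat \<Rightarrow> 'v \<Rightarrow> 'a"
  assumes \<tau>: "\<And>n. \<tau> n > 0" "\<tau> \<longlonglongrightarrow> 0"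
    and L: "\<And>n. linear (L n)" "\<And>n x. norm (L n x) = norm x" "\<And>n v. v \<in> V \<Longrightarrow> L n (\<eta> n v) = q v"
    and lim: "\<And>v. v \<in> V \<Longrightarrow> (\<lambda>n. (\<eta> n v - q v) /\<^sub>R \<tau> n) \<longlonglongrightarrow> w v"
  shows "\<exists>A\<in>killing. \<forall>v\<in>V. A (q v) = w v"
proof -
  \<comment> \<open>\<open>D\<close> measures the distance to the identity, and \<open>K n\<close>
    is the set of competitors for \<open>L n\<close>.\<close>
  define D where "D = (\<lambda>L. \<Sum>k=1..d. norm (L (b k) - b k))"
  define K where "K = (\<lambda>n. {L. linear L \<and> (\<forall>x. norm (L x) = norm x) \<and> (\<forall>v\<in>V. L (\<eta> n v) = q v)})"
  have D0: "0 \<le> D L" for L unfolding D_def by (intro sum_nonneg) simp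
  have "\<exists>L\<in>K n. \<forall>L'\<in>K n. D L \<le> D L' + \<tau> n" for n
  proof -
    have "L n \<in> K n" using L by (simp add: K_def)
    then have ne: "D ` K n \<noteq> {}" by blast
    have bdd: "bdd_below (D ` K n)" using D0 by (intro bdd_belowI2[where m = 0]) auto
    obtain L where L: "L \<in> K n" "D L < Inf (D ` K n) + \<tau> n"
      using cInf_lessD[OF ne, of "Inf (D ` K n) + \<tau> n"] \<tau>(1)[of n] by auto
    have "D L \<le> D L' + \<tau> n" if "L' \<in> K n" for L'
      using cInf_lower[OF imageI[OF that, of D] bdd] L(2) by linarith
    with L(1) show ?thesis by blast
  qed
  then obtain M where M: "\<And>n. M n \<in> K n" "\<And>n L. L \<in> K n \<Longrightarrow> D (M n) \<le> D L + \<tau> n" by metis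
  define s where "s = (\<lambda>n. D (M n))"
  have MK: "\<And>n. linear (M n)" "\<And>n x. norm (M n x) = norm x" "\<And>n v. v \<in> V \<Longrightarrow> M n (\<eta> n v) = q v"
    using M(1) by (auto simp: K_def)
  have Ms: "norm (M n (b k) - b k) \<le> s n" if "k \<in> {1..d}" for n k
    unfolding s_def D_def using that by (intro member_le_sum) auto
  have \<eta>: "(\<lambda>n. \<eta> n v) \<longlonglongrightarrow> q v" if "v \<in> V" for v
  proof -
    have "(\<lambda>n. q v + \<tau> n *\<^sub>R ((\<eta> n v - q v) /\<^sub>R \<tau> n)) \<longlonglongrightarrow> q v + 0 *\<^sub>R w v"
      by (intro tendsto_intros \<tau>(2) lim that)
    moreover have "q v + \<tau> n *\<^sub>R ((\<eta> n v - q v) /\<^sub>R \<tau> n) = \<eta> n v" for n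
      using \<tau>(1)[of n] by simp
    ultimately show ?thesis by simp
  qed
  consider (bounded) C where "\<exists>\<^sub>F n in sequentially. s n \<le> C * \<tau> n"
    | (unbounded) "\<And>C. \<forall>\<^sub>F n in sequentially. C * \<tau> n < s n"
    unfolding frequently_def not_le by blast
  then show ?thesis
  proof cases
    case bounded
    then obtain r :: "nat \<Rightarrow> nat" where r: "strict_mono r" "\<And>n. s (r n) \<le> C * \<tau> (r n)"
      using infinite_enumerate[of "{n. s n \<le> C * \<tau> n}"]
      unfolding frequently_cofinite[symmetric] cofinite_eq_sequentially by auto
    have "norm ((M (r n) (b k) - b k) /\<^sub>R \<tau> (r n)) \<le> C" if "k \<in> {1..d}" for n k
      using order_trans[OF Ms[OF that] r(2), of n] \<tau>(1)[of "r n"]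
      by (simp add: divide_inverse[symmetric] pos_divide_le_eq mult.commute[of "inverse _"])
    then obtain r' l where r': "strict_mono r'"
      "\<And>k. k \<in> {1..d} \<Longrightarrow> (\<lambda>n. (M (r (r' n)) (b k) - b k) /\<^sub>R \<tau> (r (r' n))) \<longlonglongrightarrow> l k"
      using bounded_family_convergent_subsequence_vector[OF finite_atLeastAtMost, of 1 d
        "\<lambda>n k. (M (r n) (b k) - b k) /\<^sub>R \<tau> (r n)" C] by blast
    define u where "u = r \<circ> r'"
    have u: "strict_mono u" unfolding u_def using r(1) r'(1) by (rule strict_mono_o)
    note sub = LIMSEQ_subseq_LIMSEQ[OF _ u, unfolded comp_def]
    have lim_l: "(\<lambda>n. (M (u n) (b k) - b k) /\<^sub>R \<tau> (u n)) \<longlonglongrightarrow> l k" if "k \<in> {1..d}" for k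
      using r'(2)[OF that] by (simp add: u_def)
    have \<tau>u: "\<forall>\<^sub>F n in sequentially. \<tau> (u n) \<noteq> 0" using \<tau>(1) by (intro always_eventually) (simp add: less_imp_neq[symmetric])
    note kl = killing_limit[where L = "\<lambda>n. M (u n)", OF MK(1,2) \<tau>u sub[OF \<tau>(2)] lim_l]
    \<comment> \<open>\<open>M n\<close> carries \<open>\<eta> n v\<close> back to
      \<open>q v\<close>, so the limit field is the negative of the velocity; hence the sign in the
      final witness.\<close>
    have "lin_of l (q v) = - w v" if v: "v \<in> V" for v
    proof (rule LIMSEQ_unique)
      show "(\<lambda>n. (M (u n) (\<eta> (u n) v) - \<eta> (u n) v) /\<^sub>R \<tau> (u n)) \<longlonglongrightarrow> lin_of l (q v)"
        by (rule kl(2)[OF _ sub[OF \<eta>[OF v]]])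
      have "(\<lambda>n. - ((\<eta> (u n) v - q v) /\<^sub>R \<tau> (u n))) \<longlonglongrightarrow> - w v"
        by (intro tendsto_minus sub lim v)
      then show "(\<lambda>n. (M (u n) (\<eta> (u n) v) - \<eta> (u n) v) /\<^sub>R \<tau> (u n)) \<longlonglongrightarrow> - w v"
        by (simp add: MK(3)[OF v] flip: scaleR_minus_right)
    qed
    then show ?thesis using killing_minus[OF kl(1)] by (intro bexI[of _ "\<lambda>x. - lin_of l x"]) auto
  next
    case unbounded
    have spos: "\<forall>\<^sub>F n in sequentially. s n > 0" using unbounded[of 0] by simp
    have ratio: "(\<lambda>n. \<tau> n / s n) \<longlonglongrightarrow> 0"
    proof (rule tendstoI)
      fix e :: real assume e: "e > 0"
      show "\<forall>\<^sub>F n in sequentially. dist (\<tau> n / s n) 0 < e"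
        using unbounded[of "1 / e"] spos
      proof eventually_elim
        case (elim n)
        then have "\<tau> n < e * s n" using e by (simp add: field_simps)
        then show ?case using elim \<tau>(1)[of n] by (simp add: divide_less_eq)
      qed
    qed
    \<comment> \<open>First, \<open>s\<close> tends to 0 along a subsequence: a limit
      \<open>lin_of l\<close> of the \<open>M n\<close> fixes all \<open>q v\<close>, so composition
      with its inverse \<open>N\<close> yields competitors that tend to the identity, and
      near-minimality bounds \<open>s\<close> by their distance.\<close>
    have bd: "norm (M n (b k)) \<le> (\<Sum>k=1..d. norm (b k))" if "k \<in> {1..d}" for n k
      unfolding MK(2) using that by (intro member_le_sum) auto
    obtain r l where r: "strict_mono r"
      "\<And>k. k \<in> {1..d} \<Longrightarrow> (\<lambda>n. M (r n) (b k)) \<longlonglongrightarrow> l k"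
      using bounded_family_convergent_subsequence_vector[OF finite_atLeastAtMost, of 1 d "\<lambda>n k. M n (b k)"] bd
      by blast
    note subr = LIMSEQ_subseq_LIMSEQ[OF _ r(1), unfolded comp_def]
    have Ml: "(\<lambda>n. M (r n) (y n)) \<longlonglongrightarrow> lin_of l x" if "y \<longlonglongrightarrow> x" for y x
      using r(2) by (intro tendsto_linear_family[OF MK(1) linear_lin_of _ that]) (simp add: lin_of_basis)
    have iso: "norm (lin_of l x) = norm x" for x
      using tendsto_norm[OF Ml[OF tendsto_const]] by (simp add: MK(2) LIMSEQ_const_iff)
    have fix_q: "lin_of l (q v) = q v" if "v \<in> V" for v
      using Ml[OF subr[OF \<eta>[OF that]]] by (simp add: MK(3)[OF that] LIMSEQ_const_iff)
    obtain N where N: "linear N" "\<And>x. norm (N x) = norm x" "\<And>x. N (lin_of l x) = x"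
      using linear_isometry_inverse[OF linear_lin_of iso] by metis
    have "N (q v) = q v" if "v \<in> V" for v using N(3)[of "q v"] fix_q[OF that] by simp
    then have "N \<circ> M (r n) \<in> K (r n)" for n
      using linear_compose[OF MK(1) N(1)] N(2) MK by (simp add: K_def)
    then have s_le: "s (r n) \<le> D (N \<circ> M (r n)) + \<tau> (r n)" for n
      unfolding s_def by (rule M(2))
    have "D (N \<circ> M (r n)) = (\<Sum>k=1..d. norm (M (r n) (b k) - l k))" for n
      unfolding D_def
    proof (rule sum.cong)
      fix k assume "k \<in> {1..d}"
      then have "N (l k) = b k" using N(3)[of "b k"] by (simp add: lin_of_basis)
      then show "norm ((N \<circ> M (r n)) (b k) - b k) = norm (M (r n) (b k) - l k)"
        using N(2)[of "M (r n) (b k) - l k"] by (simp add: linear_diff[OF N(1)])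
    qed simp
    moreover have "(\<lambda>n. (\<Sum>k=1..d. norm (M (r n) (b k) - l k)) + \<tau> (r n)) \<longlonglongrightarrow> (\<Sum>k=1..d. norm (l k - l k)) + 0"
      using r(2) subr[OF \<tau>(2)] by (intro tendsto_intros)
    ultimately have lim0: "(\<lambda>n. D (N \<circ> M (r n)) + \<tau> (r n)) \<longlonglongrightarrow> 0" by simp
    have s_r: "(\<lambda>n. s (r n)) \<longlonglongrightarrow> 0"
      by (rule tendsto_sandwich[OF _ _ tendsto_const lim0]) (simp_all add: s_le, simp add: s_def D0)
    have bd': "norm ((M (r n) (b k) - b k) /\<^sub>R s (r n)) \<le> 1" if "k \<in> {1..d}" for n k
    proof -
      have "0 \<le> s (r n)" by (simp add: s_def D0)
      then show ?thesis
        using Ms[OF that, of "r n"] by (cases "s (r n) = 0")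
          (simp_all add: divide_inverse[symmetric] mult.commute[of "inverse _"])
    qed
    obtain r' z where r': "strict_mono r'"
      "\<And>k. k \<in> {1..d} \<Longrightarrow> (\<lambda>n. (M (r (r' n)) (b k) - b k) /\<^sub>R s (r (r' n))) \<longlonglongrightarrow> z k"
      using bounded_family_convergent_subsequence_vector[OF finite_atLeastAtMost, of 1 d
        "\<lambda>n k. (M (r n) (b k) - b k) /\<^sub>R s (r n)" 1] bd' by blast
    define u where "u = r \<circ> r'"
    have u: "strict_mono u" unfolding u_def using r(1) r'(1) by (rule strict_mono_o)
    note sub = LIMSEQ_subseq_LIMSEQ[OF _ u, unfolded comp_def]
    have lim_z: "(\<lambda>n. (M (u n) (b k) - b k) /\<^sub>R s (u n)) \<longlonglongrightarrow> z k" if "k \<in> {1..d}" for k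
      using r'(2)[OF that] by (simp add: u_def)
    have s_u: "(\<lambda>n. s (u n)) \<longlonglongrightarrow> 0"
      using LIMSEQ_subseq_LIMSEQ[OF s_r r'(1)] by (simp add: comp_def u_def)
    have spos_u: "\<forall>\<^sub>F n in sequentially. s (u n) > 0"
      using spos filterlim_subseq[OF u] by (rule eventually_compose_filterlim)
    then have s0_u: "\<forall>\<^sub>F n in sequentially. s (u n) \<noteq> 0" by eventually_elim simp
    define B where "B = lin_of z"
    note kl = killing_limit[where L = "\<lambda>n. M (u n)", OF MK(1,2) s0_u s_u lim_z, folded B_def]
    have B: "B \<in> killing" by (rule kl(1))
    \<comment> \<open>The displacement of \<open>\<eta> n v\<close> has order
      \<open>\<tau> n\<close>, which is negligible against \<open>s n\<close>.\<close>
    have Bq: "B (q v) = 0" if v: "v \<in> V" for v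
    proof (rule LIMSEQ_unique)
      show "(\<lambda>n. (M (u n) (\<eta> (u n) v) - \<eta> (u n) v) /\<^sub>R s (u n)) \<longlonglongrightarrow> B (q v)"
        by (rule kl(2)[OF _ sub[OF \<eta>[OF v]]])
      have "(\<lambda>n. - ((\<tau> (u n) / s (u n)) *\<^sub>R ((\<eta> (u n) v - q v) /\<^sub>R \<tau> (u n)))) \<longlonglongrightarrow> - (0 *\<^sub>R w v)"
        by (intro tendsto_minus tendsto_scaleR sub[OF ratio] sub[OF lim] v)
      moreover have "- ((\<tau> n / s n) *\<^sub>R ((\<eta> n v - q v) /\<^sub>R \<tau> n)) = (q v - \<eta> n v) /\<^sub>R s n" for n
      proof -
        have "\<tau> n / s n * inverse (\<tau> n) = inverse (s n)"
          using \<tau>(1)[of n] by (cases "s n = 0") (simp_all add: field_simps)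
        then show ?thesis by (simp flip: scaleR_minus_right)
      qed
      ultimately show "(\<lambda>n. (M (u n) (\<eta> (u n) v) - \<eta> (u n) v) /\<^sub>R s (u n)) \<longlonglongrightarrow> 0"
        by (simp add: MK(3)[OF v])
    qed
    define E where "E = (\<lambda>n. flow B (- s (u n)) \<circ> M (u n))"
    have "E n \<in> K (u n)" for n
      using linear_compose[OF MK(1) linear_flow[OF B]] MK Bq
      by (auto simp: K_def E_def norm_flow[OF B] flow_fixed[OF B])
    then have s_le': "s (u n) \<le> D (E n) + \<tau> (u n)" for n
      unfolding s_def by (rule M(2))
    \<comment> \<open>The flow preserves norms, so the displacement under \<open>E n\<close> is as
      long as the difference of the displacements under \<open>M (u n)\<close> and under the flow at
      time \<open>s (u n)\<close>.\<close>
    have nE: "norm (E n x - x) = norm ((M (u n) x - x) - (flow B (s (u n)) x - x))" for n x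
    proof -
      have "E n x - x = flow B (- s (u n)) (M (u n) x - flow B (s (u n)) x)"
        by (simp add: E_def linear_diff[OF linear_flow[OF B]] flow_inverse[OF B])
      then show ?thesis by (simp add: norm_flow[OF B])
    qed
    have flow_lim: "(\<lambda>n. (flow B (s (u n)) x - x) /\<^sub>R s (u n)) \<longlonglongrightarrow> B x" for x
    proof -
      note linB = killing_linear[OF B]
      have "((\<lambda>h. (flow B h x - x) /\<^sub>R h) \<longlongrightarrow> B x) (at 0)"
        using has_vector_derivative_quotient[OF has_vector_derivative_flow[OF linB, of x 0]]
        by (simp add: flow_0[OF linB])
      moreover have "filterlim (\<lambda>n. s (u n)) (at 0) sequentially"
        using s_u s0_u by (simp add: filterlim_at)
      ultimately show ?thesis by (rule filterlim_compose)
    qed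
    \<comment> \<open>Divided by \<open>s\<close>, both displacements of \<open>b k\<close> tend to
      \<open>z k = B (b k)\<close>. So \<open>D (E n) + \<tau> (u n)\<close> eventually falls below
      \<open>s (u n)\<close>, against near-minimality.\<close>
    have "(\<lambda>n. (\<Sum>k=1..d. norm ((M (u n) (b k) - b k) /\<^sub>R s (u n) - (flow B (s (u n)) (b k) - b k) /\<^sub>R s (u n)))
        + \<tau> (u n) / s (u n)) \<longlonglongrightarrow> (\<Sum>k=1..d. norm (z k - B (b k))) + 0"
      by (intro tendsto_intros lim_z flow_lim sub[OF ratio])
    moreover have "(\<Sum>k=1..d. norm (z k - B (b k))) = 0"
      by (simp add: B_def lin_of_basis)
    ultimately have "\<forall>\<^sub>F n in sequentially. (\<Sum>k=1..d. norm ((M (u n) (b k) - b k) /\<^sub>R s (u n)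
        - (flow B (s (u n)) (b k) - b k) /\<^sub>R s (u n))) + \<tau> (u n) / s (u n) < 1"
      by (intro order_tendstoD(2)[where y = "0 + 0"]) auto
    then have "\<forall>\<^sub>F n in sequentially. False"
      using spos_u
    proof eventually_elim
      case (elim n)
      have "(\<Sum>k=1..d. norm ((M (u n) (b k) - b k) /\<^sub>R s (u n)
        - (flow B (s (u n)) (b k) - b k) /\<^sub>R s (u n))) = D (E n) / s (u n)"
        unfolding D_def nE sum_divide_distrib
        using elim(2) by (intro sum.cong refl) (simp add: divide_inverse_commute flip: scaleR_diff_right)
      then have "D (E n) + \<tau> (u n) < s (u n)"
        using elim by (simp add: divide_less_eq flip: add_divide_distrib)
      then show ?case using s_le'[of n] by simp
    qed
    then show ?thesis by simp
  qed
qed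

section \<open>The tangent space of the isometry orbit\<close>

text \<open>Velocities of infinitesimal rigid motions, translations included, extended by 0 as in
  \<open>config_space\<close>.\<close>

definition trivial_flexes :: "'v set \<Rightarrow> ('v \<Rightarrow> 'a) \<Rightarrow> ('v \<Rightarrow> 'a) set" where
  "trivial_flexes V p = {\<lambda>v. if v \<in> V then A (p v) + c else 0 | A c. A \<in> killing}"

lemma trivial_flexesI:
  "A \<in> killing \<Longrightarrow> (\<lambda>v. if v \<in> V then A (p v) + c else 0) \<in> trivial_flexes V p"
  by (auto simp: trivial_flexes_def)

text \<open>The isometries along a curve in the orbit need not depend on time in any regular way, so
  the curve is sampled at times \<open>\<tau> n\<close> and \<open>killing_of_isometries\<close>
  supplies the field. Positions relative to a base vertex \<open>v0\<close> remove the
  translations.\<close>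

lemma tangent_space_subset_trivial_flexes:
  fixes p :: "'v \<Rightarrow> 'a"
  shows "tangent_space (isometry_orbit V p) p \<subseteq> trivial_flexes V p"
proof
  fix u assume "u \<in> tangent_space (isometry_orbit V p) p"
  then obtain \<gamma> e where e: "e > 0" and \<gamma>0: "\<gamma> 0 = p"
    and orbit: "\<And>t. t \<in> {-e<..<e} \<Longrightarrow> \<gamma> t \<in> isometry_orbit V p"
    and deriv: "\<And>v. ((\<lambda>t. \<gamma> t v) has_vector_derivative u v) (at 0)"
    unfolding tangent_space_def by blast
  \<comment> \<open>The double \<open>Suc\<close> keeps \<open>\<tau> 0\<close> strictly below
    \<open>e\<close>, inside the open interval where the curve lies in the orbit.\<close>
  define \<tau> where "\<tau> = (\<lambda>n. e * inverse (real (Suc (Suc n))))"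
  have \<tau>_pos: "\<tau> n > 0" for n using e by (simp add: \<tau>_def)
  have "\<tau> n \<in> {-e<..<e}" for n
  proof -
    have "inverse (real (Suc (Suc n))) < 1" by (simp add: inverse_less_1_iff)
    then have "\<tau> n < e" using e mult_strict_left_mono[of _ 1 e] by (simp add: \<tau>_def)
    then show ?thesis using e \<tau>_pos[of n] by simp
  qed
  then have orb: "\<gamma> (\<tau> n) \<in> isometry_orbit V p" for n by (rule orbit)
  have \<tau>_lim: "\<tau> \<longlonglongrightarrow> 0"
    unfolding \<tau>_def using tendsto_mult_left[OF LIMSEQ_Suc[OF LIMSEQ_inverse_real_of_nat], of e] by simp
  have lim: "(\<lambda>n. (\<gamma> (\<tau> n) v - p v) /\<^sub>R \<tau> n) \<longlonglongrightarrow> u v" for v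
  proof -
    have "((\<lambda>h. (\<gamma> h v - p v) /\<^sub>R h) \<longlongrightarrow> u v) (at 0)"
      using has_vector_derivative_quotient[OF deriv[of v]] by (simp add: \<gamma>0)
    moreover have "filterlim \<tau> (at 0) sequentially"
      using \<tau>_lim \<tau>_pos by (simp add: filterlim_at less_imp_neq[symmetric])
    ultimately show ?thesis by (rule filterlim_compose)
  qed
  have p: "p \<in> isometry_orbit V p" using orbit[of 0] e \<gamma>0 by simp
  have outside: "u v = 0" if "v \<notin> V" for v
  proof -
    have "\<gamma> (\<tau> n) v = 0" for n using orb that by (simp add: isometry_orbit_def config_space_def)
    moreover have "p v = 0" using p that by (simp add: isometry_orbit_def config_space_def)
    ultimately show ?thesis using lim[of v] by (simp add: LIMSEQ_const_iff)
  qed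
  show "u \<in> trivial_flexes V p"
  proof (cases "V = {}")
    case True
    then have "u = (\<lambda>v. if v \<in> V then 0 + 0 else 0)" using outside by auto
    then show ?thesis using trivial_flexesI[OF killing_zero, where V = V and p = p and c = 0] by simp
  next
    case False
    then obtain v0 where v0: "v0 \<in> V" by blast
    have "\<exists>L. linear L \<and> (\<forall>x. norm (L x) = norm x) \<and>
        (\<forall>v\<in>V. L (\<gamma> (\<tau> n) v - \<gamma> (\<tau> n) v0) = p v - p v0)" for n
    proof -
      obtain T where T: "isometry_map T" "\<And>v. v \<in> V \<Longrightarrow> p v = T (\<gamma> (\<tau> n) v)"
        using orb[of n] unfolding isometry_orbit_def by blast
      obtain L c where L: "linear L" "\<And>x. norm (L x) = norm x" "\<And>x. T x = L x + c"
        using isometry_affine[OF T(1)] by metis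
      then show ?thesis using T(2) v0 by (intro exI[of _ L]) (simp add: linear_diff)
    qed
    then obtain L where L: "\<And>n. linear (L n)" "\<And>n x. norm (L n x) = norm x"
      "\<And>n v. v \<in> V \<Longrightarrow> L n (\<gamma> (\<tau> n) v - \<gamma> (\<tau> n) v0) = p v - p v0" by metis
    have lim': "(\<lambda>n. ((\<gamma> (\<tau> n) v - \<gamma> (\<tau> n) v0) - (p v - p v0)) /\<^sub>R \<tau> n) \<longlonglongrightarrow> u v - u v0" for v
      using tendsto_diff[OF lim[of v] lim[of v0]]
      by (simp add: algebra_simps)
    have "\<exists>A\<in>killing. \<forall>v\<in>V. A (p v - p v0) = u v - u v0"
      by (rule killing_of_isometries[where \<eta> = "\<lambda>n v. \<gamma> (\<tau> n) v - \<gamma> (\<tau> n) v0", OF \<tau>_pos \<tau>_lim L lim'])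
    then obtain A where A: "A \<in> killing" "\<And>v. v \<in> V \<Longrightarrow> A (p v - p v0) = u v - u v0" by blast
    have "u = (\<lambda>v. if v \<in> V then A (p v) + (u v0 - A (p v0)) else 0)"
    proof
      fix v
      have "A (p v) + (u v0 - A (p v0)) = u v" if "v \<in> V"
        using A(2)[OF that] by (simp add: linear_diff[OF killing_linear[OF A(1)]] algebra_simps)
      then show "u v = (if v \<in> V then A (p v) + (u v0 - A (p v0)) else 0)" using outside by simp
    qed
    then show ?thesis by (rule ssubst) (rule trivial_flexesI[OF A(1)])
  qed
qed

lemma tangent_spaceI:
  fixes p :: "'v \<Rightarrow> 'a"
  assumes "\<gamma> 0 = p" "\<And>t. \<gamma> t \<in> M"
    and deriv: "\<And>t v. ((\<lambda>t. \<gamma> t v) has_vector_derivative D v t) (at t)"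
    and cont: "\<And>v. continuous_on UNIV (D v)"
  shows "(\<lambda>v. D v 0) \<in> tangent_space M p"
proof -
  have "(\<lambda>t. \<gamma> t v) C1_differentiable_on {-1<..<1}" for v
    unfolding C1_differentiable_on_def using deriv continuous_on_subset[OF cont[of v]] by blast
  then show ?thesis
    unfolding tangent_space_def using assms(1,2) deriv by (intro CollectI exI[of _ \<gamma>] exI[of _ 1]) simp
qed

text \<open>The two summands are velocities of separate curves: the flow of \<open>A\<close> and a
  uniform translation. Passing to the span allows adding them, and \<open>dim\<close> depends on the
  span only.\<close>

lemma trivial_flexes_subset_span:
  fixes p :: "'v \<Rightarrow> 'a"
  assumes p: "p \<in> config_space V"
  shows "trivial_flexes V p \<subseteq> span (tangent_space (isometry_orbit V p) p)"
proof
  let ?T = "tangent_space (isometry_orbit V p) p"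
  fix u assume "u \<in> trivial_flexes V p"
  then obtain A c where A: "A \<in> killing" and u: "u = (\<lambda>v. if v \<in> V then A (p v) + c else 0)"
    by (auto simp: trivial_flexes_def)
  note lin = killing_linear[OF A]
  have "(\<lambda>v. if v \<in> V then A (flow A 0 (p v)) else 0) \<in> ?T"
  proof (rule tangent_spaceI[where \<gamma> = "\<lambda>t v. if v \<in> V then flow A t (p v) else 0"
        and D = "\<lambda>v t. if v \<in> V then A (flow A t (p v)) else 0"])
    show "(\<lambda>v. if v \<in> V then flow A 0 (p v) else 0) = p"
      using p by (auto simp: flow_0[OF lin] config_space_def)
    show "(\<lambda>v. if v \<in> V then flow A t (p v) else 0) \<in> isometry_orbit V p" for t
    proof -
      \<comment> \<open>Membership in the orbit asks for an isometry from the moved points back to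
        \<open>p\<close>, hence the flow at time \<open>- t\<close>.\<close>
      have "isometry_map (flow A (- t))"
        by (rule isometry_mapI[OF linear_flow[OF A] norm_flow[OF A], where c = 0]) simp
      then show ?thesis
        by (auto simp: isometry_orbit_def config_space_def flow_inverse[OF A] intro!: exI[of _ "flow A (- t)"])
    qed
    show "((\<lambda>t. if v \<in> V then flow A t (p v) else 0) has_vector_derivative
        (if v \<in> V then A (flow A t (p v)) else 0)) (at t)" for t v
      by (cases "v \<in> V") (simp_all add: has_vector_derivative_flow[OF lin])
    show "continuous_on UNIV (\<lambda>t. if v \<in> V then A (flow A t (p v)) else 0)" for v
    proof (cases "v \<in> V")
      case True
      have "continuous_on UNIV (\<lambda>t. A (flow A t (p v)))"
        using has_vector_derivative_continuous[OF has_vector_derivative_flow[OF lin]]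
        by (intro continuous_at_imp_continuous_on ballI
            bounded_linear.isCont[OF linear_imp_bounded_linear[OF lin]]) blast
      then show ?thesis using True by simp
    qed simp
  qed
  moreover have "(\<lambda>v. if v \<in> V then c else 0) \<in> ?T"
  proof (rule tangent_spaceI[where \<gamma> = "\<lambda>t v. if v \<in> V then p v + t *\<^sub>R c else 0"
        and D = "\<lambda>v t. if v \<in> V then c else 0"])
    show "(\<lambda>v. if v \<in> V then p v + 0 *\<^sub>R c else 0) = p"
      using p by (auto simp: config_space_def)
    show "(\<lambda>v. if v \<in> V then p v + t *\<^sub>R c else 0) \<in> isometry_orbit V p" for t
      by (auto simp: isometry_orbit_def config_space_def isometry_map_def dist_norm
          intro!: exI[of _ "\<lambda>x. x - t *\<^sub>R c"])
    show "((\<lambda>t. if v \<in> V then p v + t *\<^sub>R c else 0) has_vector_derivative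
        (if v \<in> V then c else 0)) (at t)" for t v
      by (cases "v \<in> V") (auto intro!: derivative_eq_intros)
  qed simp
  ultimately have "(\<lambda>v. if v \<in> V then A (flow A 0 (p v)) else 0) + (\<lambda>v. if v \<in> V then c else 0) \<in> span ?T"
    by (intro real_vector.span_add real_vector.span_base)
  moreover have "(\<lambda>v. if v \<in> V then A (flow A 0 (p v)) else 0) + (\<lambda>v. if v \<in> V then c else 0) = u"
    by (auto simp: u flow_0[OF lin])
  ultimately show "u \<in> span ?T" by simp
qed

lemma dim_tangent_space_orbit:
  fixes p :: "'v \<Rightarrow> 'a"
  assumes "p \<in> config_space V"
  shows "dim (tangent_space (isometry_orbit V p) p) = dim (trivial_flexes V p)"
proof (rule real_vector.span_eq_dim)
  show "span (tangent_space (isometry_orbit V p) p) = span (trivial_flexes V p)"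
    using real_vector.span_mono[OF tangent_space_subset_trivial_flexes[of V p]]
      real_vector.span_minimal[OF trivial_flexes_subset_span[OF assms] real_vector.subspace_span] by blast
qed

end

section \<open>Rigidity matrices\<close>

lemma finite_simple_graph_edgeE:
  assumes "finite_simple_graph V E" "e \<in> E"
  obtains v w where "e = {v, w}" "v \<noteq> w" "v \<in> V" "w \<in> V"
  using assms unfolding finite_simple_graph_def by blast

lemma finite_simple_graph_finite:
  assumes "finite_simple_graph V E"
  shows "finite V" "finite E"
proof -
  show V: "finite V" using assms by (simp add: finite_simple_graph_def)
  have "E \<subseteq> Pow V" using assms by (auto elim!: finite_simple_graph_edgeE)
  then show "finite E" using V by (simp add: finite_subset)
qed

lemma the_other_endpoint: "(THE w'. {v, w} = {v, w'}) = w"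
  by (rule the_equality) (auto simp: doubleton_eq_iff)

section \<open>Open conditions on placements\<close>

text \<open>Sequential openness for coordinatewise convergence, the form delivered by
  \<open>indep_family_eventually\<close>.\<close>

definition open_property :: "(('v \<Rightarrow> 'b::topological_space) \<Rightarrow> bool) \<Rightarrow> bool" where
  "open_property P \<longleftrightarrow> (\<forall>p q. P p \<longrightarrow> (\<forall>v. (\<lambda>n. q n v) \<longlonglongrightarrow> p v) \<longrightarrow>
     (\<forall>\<^sub>F n in sequentially. P (q n)))"

lemma open_property_conj:
  "open_property P \<Longrightarrow> open_property Q \<Longrightarrow> open_property (\<lambda>p. P p \<and> Q p)"
  unfolding open_property_def by (simp only: eventually_conj_iff) blast

lemma open_property_edges_distinct:
  assumes "finite_simple_graph V E"
  shows "open_property (\<lambda>p. \<forall>v w. {v, w} \<in> E \<longrightarrow> p v \<noteq> (p w :: 'b::t2_space))"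
  unfolding open_property_def
proof (intro allI impI)
  fix p :: "'a \<Rightarrow> 'b" and q
  assume p: "\<forall>v w. {v, w} \<in> E \<longrightarrow> p v \<noteq> p w" and q: "\<forall>v. (\<lambda>n. q n v) \<longlonglongrightarrow> p v"
  have "{(v, w). {v, w} \<in> E} \<subseteq> V \<times> V"
    using assms by (auto simp: doubleton_eq_iff elim!: finite_simple_graph_edgeE)
  then have fin: "finite {(v, w). {v, w} \<in> E}"
    using finite_simple_graph_finite[OF assms] by (meson finite_SigmaI finite_subset)
  have "\<forall>\<^sub>F n in sequentially. q n v \<noteq> q n w" if "{v, w} \<in> E" for v w
  proof -
    have "p v \<noteq> p w" using p that by blast
    from hausdorff[OF this]
    obtain U W where "open U" "open W" "p v \<in> U" "p w \<in> W" "U \<inter> W = {}" by blast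
    then have "\<forall>\<^sub>F n in sequentially. q n v \<in> U \<and> q n w \<in> W"
      using q by (auto intro!: eventually_conj topological_tendstoD)
    then show ?thesis using \<open>U \<inter> W = {}\<close> by (auto elim!: eventually_mono)
  qed
  then have "\<forall>\<^sub>F n in sequentially. \<forall>x\<in>{(v, w). {v, w} \<in> E}. q n (fst x) \<noteq> q n (snd x)"
    using fin by (intro eventually_ball_finite) auto
  then show "\<forall>\<^sub>F n in sequentially. \<forall>v w. {v, w} \<in> E \<longrightarrow> q n v \<noteq> q n w"
    by (rule eventually_mono) auto
qed

context smooth_strictly_convex
begin

lemma rigidity_row_endpoint:
  "k \<in> {1..d} \<Longrightarrow> rigidity_row b p {v, w} (v, k) = \<phi> (p v - p w) (b k)"
  by (simp add: rigidity_row_def the_other_endpoint flip: dim_UNIV)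

lemma rigidity_row_eq_0: "u \<notin> e \<or> k \<notin> {1..d} \<Longrightarrow> rigidity_row b p e (u, k) = 0"
  by (auto simp: rigidity_row_def simp flip: dim_UNIV)

lemma rigidity_row_cong:
  fixes x y :: 'v
  assumes "\<And>v. v \<in> {x, y} \<Longrightarrow> p v = q v"
  shows "rigidity_row b p {x, y} = rigidity_row b q {x, y}"
proof
  fix i :: "'v \<times> nat"
  obtain u k where i: "i = (u, k)" by fastforce
  consider "u = x" "k \<in> {1..d}" | "u = y" "k \<in> {1..d}" | "u \<notin> {x, y} \<or> k \<notin> {1..d}" by auto
  then show "rigidity_row b p {x, y} i = rigidity_row b q {x, y} i"
  proof cases
    case 1
    then show ?thesis using assms by (simp add: i rigidity_row_endpoint)
  next
    case 2
    then show ?thesis using assms rigidity_row_endpoint[of k _ y x] by (simp add: i insert_commute)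
  next
    case 3
    then show ?thesis by (simp add: i rigidity_row_eq_0)
  qed
qed

lemma tendsto_rigidity_row:
  fixes x y :: 'v
  assumes "\<And>v. (\<lambda>n. q n v) \<longlonglongrightarrow> p v"
  shows "(\<lambda>n. rigidity_row b (q n) {x, y} i) \<longlonglongrightarrow> rigidity_row b p {x, y} i"
proof -
  obtain u k where i: "i = (u, k)" by fastforce
  have lim: "(\<lambda>n. \<phi> (q n v - q n w) (b k)) \<longlonglongrightarrow> \<phi> (p v - p w) (b k)" for v w
    by (intro tendsto_phi tendsto_intros assms)
  consider "u = x" "k \<in> {1..d}" | "u = y" "k \<in> {1..d}" | "u \<notin> {x, y} \<or> k \<notin> {1..d}" by auto
  then show ?thesis
  proof cases
    case 1
    then show ?thesis using lim by (simp add: i rigidity_row_endpoint)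
  next
    case 2
    then show ?thesis using lim rigidity_row_endpoint[of k _ y x] by (simp add: i insert_commute)
  next
    case 3
    then show ?thesis by (simp add: i rigidity_row_eq_0)
  qed
qed

lemma well_positioned_iff_placement:
  "well_positioned V E p \<longleftrightarrow> placement V E (p :: 'v \<Rightarrow> 'a)"
  using smooth by (auto simp: well_positioned_def placement_def smooth_space_def)

lemma independent_framework_iff:
  assumes "finite_simple_graph V E"
  shows "independent_framework b V E p \<longleftrightarrow>
    placement V E p \<and> indep_family E (V \<times> {1..d}) (rigidity_row b p)"
proof -
  have "rigidity_row b p e i = 0" if "e \<in> E" "i \<notin> V \<times> {1..d}" for e i
    using that assms by (cases i) (auto elim!: finite_simple_graph_edgeE intro!: rigidity_row_eq_0)
  then have "indep_family E UNIV (rigidity_row b p) \<longleftrightarrow> indep_family E (V \<times> {1..d}) (rigidity_row b p)"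
    by (rule indep_family_UNIV_eq)
  then show ?thesis
    using indep_family_UNIV_iff[OF finite_simple_graph_finite(2)[OF assms]]
    by (auto simp: independent_framework_def well_positioned_iff_placement)
qed

section \<open>Pairing of matrix rows with flexes\<close>

text \<open>Velocities laid out along the columns of the rigidity matrix, so that they can be paired
  with its rows.\<close>

definition flex_coord :: "('v \<Rightarrow> 'a) \<Rightarrow> 'v \<times> nat \<Rightarrow> real" where
  "flex_coord u = (\<lambda>(v, k). coord k (u v))"

text \<open>A row lives on its two endpoints, and since \<open>\<phi>\<close> is odd the two
  contributions combine into one functional applied to the relative velocity.\<close>

lemma rigidity_row_flex:
  assumes "finite V" "v \<in> V" "w \<in> V" "v \<noteq> w"
  shows "(\<Sum>i\<in>V \<times> {1..d}. rigidity_row b p {v, w} i * flex_coord u i) = \<phi> (p v - p w) (u v - u w)"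
proof -
  let ?r = "\<lambda>x. \<Sum>k=1..d. rigidity_row b p {v, w} (x, k) * coord k (u x)"
  have end1: "?r v = \<phi> (p v - p w) (u v)"
    by (subst linear_eq_sum_coord[OF linear_phi, of "p v - p w" "u v"])
      (simp add: rigidity_row_endpoint mult.commute)
  have end2: "?r w = \<phi> (p w - p v) (u w)"
    using rigidity_row_endpoint[of _ p w v]
    by (subst linear_eq_sum_coord[OF linear_phi, of "p w - p v" "u w"])
      (simp add: insert_commute mult.commute)
  have "(\<Sum>i\<in>V \<times> {1..d}. rigidity_row b p {v, w} i * flex_coord u i) = (\<Sum>x\<in>V. ?r x)"
    by (simp add: sum.cartesian_product flex_coord_def case_prod_beta)
  also have "\<dots> = (\<Sum>x\<in>{v, w}. ?r x)"
    using assms by (intro sum.mono_neutral_right) (auto simp: rigidity_row_eq_0)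
  also have "\<dots> = \<phi> (p v - p w) (u v) + \<phi> (p w - p v) (u w)" using assms(4) end1 end2 by simp
  also have "\<dots> = \<phi> (p v - p w) (u v - u w)"
    using phi_minus[of "p v - p w" "u w"] by (simp add: linear_diff[OF linear_phi])
  finally show ?thesis .
qed

text \<open>The relative velocity of an edge is \<open>A (p v - p w)\<close>, annihilated by the
  functional of the edge. So rows and trivial flexes are orthogonal in a space of dimension
  \<open>d * card V\<close>.\<close>

lemma card_edges_flexes_le:
  assumes graph: "finite_simple_graph V E" and J: "finite J"
    and rows: "indep_family E (V \<times> {1..d}) (rigidity_row b p)"
    and u: "\<And>j. j \<in> J \<Longrightarrow> u j \<in> trivial_flexes V p"
    and flexes: "indep_family J (V \<times> {1..d}) (\<lambda>j. flex_coord (u j))"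
  shows "card E + card J \<le> d * card V"
proof -
  note fin = finite_simple_graph_finite[OF graph]
  have "card E + card J \<le> card (V \<times> {1..d})"
  proof (rule indep_family_orthogonal_card_le[OF fin(2) J _ rows flexes])
    fix e j assume ej: "e \<in> E" "j \<in> J"
    obtain v w where e: "e = {v, w}" "v \<noteq> w" "v \<in> V" "w \<in> V"
      using finite_simple_graph_edgeE[OF graph ej(1)] by blast
    obtain A c where A: "A \<in> killing" "u j = (\<lambda>v. if v \<in> V then A (p v) + c else 0)"
      using u[OF ej(2)] by (auto simp: trivial_flexes_def)
    show "(\<Sum>i\<in>V \<times> {1..d}. rigidity_row b p e i * flex_coord (u j) i) = 0"
    proof -
      have "u j v - u j w = A (p v - p w)"
        using e by (simp add: A(2) linear_diff[OF killing_linear[OF A(1)]])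
      then show ?thesis
        unfolding e(1) rigidity_row_flex[OF fin(1) e(3,4,2)] by (simp add: killing_phi[OF A(1)])
    qed
  qed (use fin in simp)
  then show ?thesis by (simp add: card_cartesian_product mult.commute)
qed

lemma indep_family_flex_coord_iff:
  assumes "\<And>j v. j \<in> J \<Longrightarrow> v \<notin> V \<Longrightarrow> u j v = 0"
  shows "indep_family J (V \<times> {1..d}) (\<lambda>j. flex_coord (u j)) \<longleftrightarrow>
    (\<forall>c. (\<Sum>j\<in>J. c j *\<^sub>R u j) = 0 \<longrightarrow> (\<forall>j\<in>J. c j = 0))"
proof -
  have coord: "(\<Sum>j\<in>J. c j * flex_coord (u j) (v, k)) = coord k (\<Sum>j\<in>J. c j *\<^sub>R u j v)" for c v k
    by (simp add: flex_coord_def linear_sum[OF linear_coord] linear_cmul[OF linear_coord])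
  have "(\<forall>i\<in>V \<times> {1..d}. (\<Sum>j\<in>J. c j * flex_coord (u j) i) = 0) \<longleftrightarrow> (\<Sum>j\<in>J. c j *\<^sub>R u j) = 0" for c
  proof
    assume L: "\<forall>i\<in>V \<times> {1..d}. (\<Sum>j\<in>J. c j * flex_coord (u j) i) = 0"
    have "(\<Sum>j\<in>J. c j *\<^sub>R u j v) = 0" for v
    proof (cases "v \<in> V")
      case True
      then show ?thesis
        using L by (intro coord_eqI) (simp add: linear_0[OF linear_coord] flip: coord)
    qed (simp add: assms)
    then show "(\<Sum>j\<in>J. c j *\<^sub>R u j) = 0" by (simp add: fun_eq_iff sum_fun_apply scaleR_fun_def)
  next
    assume R: "(\<Sum>j\<in>J. c j *\<^sub>R u j) = 0"
    have "(\<Sum>j\<in>J. c j *\<^sub>R u j v) = 0" for v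
      using fun_cong[OF R, of v] by (simp add: sum_fun_apply scaleR_fun_def)
    then show "\<forall>i\<in>V \<times> {1..d}. (\<Sum>j\<in>J. c j * flex_coord (u j) i) = 0"
      by (auto simp: coord linear_0[OF linear_coord])
  qed
  then show ?thesis by (simp add: indep_family_def)
qed

section \<open>Support functionals in general position\<close>

text \<open>The coordinates of a nonzero \<open>z\<close> would be orthogonal to \<open>d\<close>
  independent vectors of length \<open>d\<close>.\<close>

lemma annihilated_by_phi_family:
  assumes "finite S" "card S = d" "indep_family S {1..d} (\<lambda>w k. f w (b k))"
    and f: "\<And>w. w \<in> S \<Longrightarrow> linear (f w)" "\<And>w. w \<in> S \<Longrightarrow> f w z = (0::real)"
  shows "z = 0"
proof (rule ccontr)
  assume "z \<noteq> 0"
  then obtain k where k: "k \<in> {1..d}" "coord k z \<noteq> 0"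
    using coord_eqI[of z 0] by (auto simp: linear_0[OF linear_coord])
  have "card S + card {()} \<le> card {1..d}"
  proof (rule indep_family_orthogonal_card_le[OF assms(1) _ _ assms(3)])
    show "indep_family {()} {1..d} (\<lambda>_ k. coord k z)"
      using k by (auto simp: indep_family_def)
    show "(\<Sum>i=1..d. f w (b i) * coord i z) = 0" if "w \<in> S" for w
      using linear_eq_sum_coord[OF f(1)[OF that], of z] f(2)[OF that] by (simp add: mult.commute)
  qed simp_all
  then show False using assms(2) by simp
qed

text \<open>Fewer than \<open>d\<close> linear equations in \<open>d\<close> unknowns: the
  transposed family has too many members to be independent.\<close>

lemma ex_annihilated:
  assumes "finite S" "card S < d" "\<And>w. w \<in> S \<Longrightarrow> linear (f w)"
  obtains z :: 'a where "z \<noteq> 0" "\<And>w. w \<in> S \<Longrightarrow> f w z = (0::real)"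
proof -
  have "\<not> indep_family {1..d} S (\<lambda>k w. f w (b k))"
    using indep_family_card_le[of "{1..d}" S] assms(1,2) by force
  then obtain c k where c: "\<And>w. w \<in> S \<Longrightarrow> (\<Sum>k=1..d. c k * f w (b k)) = 0" "k \<in> {1..d}" "c k \<noteq> 0"
    unfolding indep_family_def by blast
  define z where "z = (\<Sum>k=1..d. c k *\<^sub>R b k)"
  have "z \<noteq> 0" using basis_scalars_zero[of c k] c(2,3) by (auto simp: z_def)
  moreover have "f w z = 0" if "w \<in> S" for w
    using c(1)[OF that] by (simp add: z_def linear_sum[OF assms(3)[OF that]] linear_cmul[OF assms(3)[OF that]])
  ultimately show ?thesis using that by blast
qed

text \<open>The points \<open>p w\<close> are moved one by one: if \<open>z\<close> is annihilated by the functionals obtained so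
  far and also by the next one, an arbitrarily small shift of the next point in direction \<open>z\<close>
  destroys the latter.\<close>

lemma perturb_to_independent_phi:
  assumes P: "open_property P" "P p" and "finite S" "card S \<le> d"
  shows "\<exists>q. P q \<and> (\<forall>v. v \<notin> S \<longrightarrow> q v = (p v :: 'a)) \<and>
    indep_family S {1..d} (\<lambda>w k. \<phi> (x - q w) (b k))"
  using assms(3,4)
proof (induction S rule: finite_induct)
  case empty
  then show ?case using P(2) by (auto simp: indep_family_def)
next
  case (insert w S)
  then obtain q where q: "P q" "\<And>v. v \<notin> S \<Longrightarrow> q v = p v"
    "indep_family S {1..d} (\<lambda>w k. \<phi> (x - q w) (b k))" by auto
  have "card S < d" using insert by simp
  then obtain z where z: "z \<noteq> 0" "\<And>w. w \<in> S \<Longrightarrow> \<phi> (x - q w) z = 0"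
    using ex_annihilated[OF insert.hyps(1), of "\<lambda>w. \<phi> (x - q w)"] linear_phi by blast
  \<comment> \<open>Subtracting a multiple of \<open>z\<close> from \<open>q w\<close> moves
    \<open>x - q w\<close> in direction \<open>z\<close>; the multiples are nonzero and tend to
    0.\<close>
  define q' where "q' = (\<lambda>n. q(w := q w - inverse (real (Suc n)) *\<^sub>R z))"
  have "(\<lambda>n. q w - inverse (real (Suc n)) *\<^sub>R z) \<longlonglongrightarrow> q w - 0 *\<^sub>R z"
    by (intro tendsto_intros LIMSEQ_inverse_real_of_nat)
  then have "(\<lambda>n. q' n v) \<longlonglongrightarrow> q v" for v by (cases "v = w") (simp_all add: q'_def)
  then have "\<forall>\<^sub>F n in sequentially. P (q' n)" using P(1) q(1) unfolding open_property_def by blast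
  then obtain n where n: "P (q' n)" by (auto simp: eventually_sequentially)
  obtain r where r: "P r" "\<And>v. v \<noteq> w \<Longrightarrow> r v = q v" "\<phi> (x - r w) z \<noteq> 0"
  proof (cases "\<phi> (x - q w) z = 0")
    case True
    have "\<phi> (x - q w + inverse (real (Suc n)) *\<^sub>R z) z \<noteq> 0"
      using phi_zero_unique_on_line[OF True _ z(1)] by (metis inverse_nonzero_iff_nonzero of_nat_Suc of_nat_eq_0_iff Suc_neq_Zero)
    moreover have "x - q' n w = x - q w + inverse (real (Suc n)) *\<^sub>R z"
      by (simp add: q'_def)
    ultimately have "\<phi> (x - q' n w) z \<noteq> 0" by (simp only: not_False_eq_True)
    moreover have "q' n v = q v" if "v \<noteq> w" for v using that by (simp add: q'_def)
    ultimately show ?thesis using that[of "q' n"] n by blast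
  next
    case False
    then show ?thesis using that[of q] q(1) by simp
  qed
  have rS: "r v = q v" if "v \<in> S" for v using r(2) that insert.hyps(2) by metis
  have "indep_family (insert w S) {1..d} (\<lambda>w k. \<phi> (x - r w) (b k))"
  proof (rule indep_familyI)
    fix c j
    assume c: "\<And>k. k \<in> {1..d} \<Longrightarrow> (\<Sum>v\<in>insert w S. c v * \<phi> (x - r v) (b k)) = 0" and j: "j \<in> insert w S"
    have split: "(\<Sum>v\<in>insert w S. c v * \<phi> (x - r v) y) = c w * \<phi> (x - r w) y + (\<Sum>v\<in>S. c v * \<phi> (x - q v) y)" for y
      using insert.hyps rS by (simp cong: sum.cong)
    have "linear (\<lambda>y. \<Sum>v\<in>insert w S. c v *\<^sub>R \<phi> (x - r v) y)"
      by (intro linear_compose_sum ballI linear_compose_scale_right linear_phi)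
    \<comment> \<open>Evaluated at \<open>z\<close>, the relation loses all terms from
      \<open>S\<close> and isolates \<open>c w\<close>.\<close>
    then have "(\<Sum>v\<in>insert w S. c v * \<phi> (x - r v) z) = (\<Sum>k=1..d. coord k z * (\<Sum>v\<in>insert w S. c v * \<phi> (x - r v) (b k)))"
      using linear_eq_sum_coord[of "\<lambda>y. \<Sum>v\<in>insert w S. c v *\<^sub>R \<phi> (x - r v) y" z] by simp
    also have "\<dots> = 0" using c by simp
    finally have cw: "c w = 0" using r(3) z(2) by (simp add: split)
    then have "(\<Sum>v\<in>S. c v * \<phi> (x - q v) (b k)) = 0" if "k \<in> {1..d}" for k
      using c[OF that] by (simp add: split)
    then show "c j = 0" using indep_familyD[OF q(3)] cw j by blast
  qed
  then show ?case using r(1,2) q(2) by (intro exI[of _ r]) auto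
qed

section \<open>Zero-extensions\<close>

text \<open>A common form of both graph properties: \<open>m = 0\<close> for independence and
  \<open>m = d * card V - card E\<close> for minimal rigidity. The fields, given by
  \<open>A j\<close> and \<open>c j\<close>, do not depend on \<open>p\<close>, so they can be kept
  while the placement is perturbed.\<close>

definition independent_with_flexes :: "'v set \<Rightarrow> 'v set set \<Rightarrow> nat \<Rightarrow> bool" where
  "independent_with_flexes V E m \<longleftrightarrow> (\<exists>(p :: 'v \<Rightarrow> 'a) A c. independent_framework b V E p \<and>
     (\<forall>j<m. A j \<in> killing) \<and>
     indep_family {..<m} (V \<times> {1..d}) (\<lambda>j. flex_coord (\<lambda>v. A j (p v) + c j)))"

lemma independent_graph_iff: "independent_graph b V E \<longleftrightarrow> independent_with_flexes V E 0"
  by (auto simp: independent_graph_def independent_with_flexes_def indep_family_def)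

text \<open>Independent rows have the largest conceivable rank \<open>card E\<close>, which settles
  regularity and turns rigidity into an equation for the dimension of the trivial flexes. By
  \<open>card_edges_flexes_le\<close> this dimension never exceeds the required number, so enough
  independent flexes suffice.\<close>

lemma minimally_rigid_graph_iff:
  assumes graph: "finite_simple_graph V E"
  shows "minimally_rigid_graph b V E \<longleftrightarrow> independent_with_flexes V E (d * card V - card E)"
    (is "_ \<longleftrightarrow> independent_with_flexes V E ?m")
proof
  note fin = finite_simple_graph_finite[OF graph]
  have rank: "rigidity_rank b E p = card E" if "independent_framework b V E p" for p
    using that by (simp add: rigidity_rank_def independent_framework_def
        real_vector.dim_eq_card_independent card_image)
  {
    assume "minimally_rigid_graph b V E"
    then obtain p where p: "rigid_framework b V E p" "independent_framework b V E p"
      by (auto simp: minimally_rigid_graph_def minimally_rigid_framework_def)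
    have "p \<in> config_space V"
      using p(2) by (simp add: independent_framework_def well_positioned_def placement_def)
    then have "int (card E) = int (d * card V) - int (dim (trivial_flexes V p))"
      using p(1) rank[OF p(2)]
      by (simp add: rigid_framework_def dim_tangent_space_orbit dim_UNIV del: of_nat_mult)
    then have dim: "dim (trivial_flexes V p) = ?m" by linarith
    obtain B where B: "B \<subseteq> trivial_flexes V p" "independent B" "card B = ?m"
      using real_vector.basis_exists[of "trivial_flexes V p"] dim by metis
    \<comment> \<open>An infinite \<open>B\<close> would also have cardinality 0, so finiteness of
      \<open>B\<close> is available only for \<open>?m \<noteq> 0\<close>.\<close>
    show "independent_with_flexes V E ?m"
    proof (cases "?m = 0")
      case True
      then show ?thesis using p(2) unfolding independent_with_flexes_def by (auto simp: indep_family_def)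
    next
      case False
      then have "finite B" using B(3) card.infinite by fastforce
      then obtain h where h: "bij_betw h {..<?m} B"
        using ex_bij_betw_nat_finite[of B] B(3) by (auto simp: atLeast0LessThan)
      have "\<exists>A c. A \<in> killing \<and> h j = (\<lambda>v. if v \<in> V then A (p v) + c else 0)" if "j < ?m" for j
        using bij_betwE[OF h] that B(1) by (fastforce simp: trivial_flexes_def)
      then obtain A c where A: "\<And>j. j < ?m \<Longrightarrow> A j \<in> killing"
        "\<And>j. j < ?m \<Longrightarrow> h j = (\<lambda>v. if v \<in> V then A j (p v) + c j else 0)" by metis
      have "inj_on h {..<?m} \<and> independent (h ` {..<?m})"
        using h B(2) by (simp add: bij_betw_def)
      moreover have "h j v = 0" if "j \<in> {..<?m}" "v \<notin> V" for j v
        using that by (simp add: A(2))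
      ultimately have "indep_family {..<?m} (V \<times> {1..d}) (\<lambda>j. flex_coord (h j))"
        using indep_family_flex_coord_iff[of "{..<?m}" V h] independent_image_iff[of "{..<?m}" h]
        by blast
      moreover have "flex_coord (h j) i = flex_coord (\<lambda>v. A j (p v) + c j) i"
        if "j \<in> {..<?m}" "i \<in> V \<times> {1..d}" for j i
        using that by (auto simp: A(2) flex_coord_def)
      ultimately have "indep_family {..<?m} (V \<times> {1..d}) (\<lambda>j. flex_coord (\<lambda>v. A j (p v) + c j))"
        using indep_family_cong[of "{..<?m}" "V \<times> {1..d}" "\<lambda>j. flex_coord (h j)"
            "\<lambda>j. flex_coord (\<lambda>v. A j (p v) + c j)"] by blast
      then show ?thesis using p(2) A(1) unfolding independent_with_flexes_def by blast
    qed
  }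
  {
    assume "independent_with_flexes V E ?m"
    then obtain p A c where p: "independent_framework b V E p" and A: "\<And>j. j < ?m \<Longrightarrow> A j \<in> killing"
      and ind: "indep_family {..<?m} (V \<times> {1..d}) (\<lambda>j. flex_coord (\<lambda>v. A j (p v) + c j))"
      unfolding independent_with_flexes_def by blast
    have config: "p \<in> config_space V"
      using p by (simp add: independent_framework_def well_positioned_def placement_def)
    have rows: "indep_family E (V \<times> {1..d}) (rigidity_row b p)"
      using p independent_framework_iff[OF graph] by blast
    define u where "u = (\<lambda>j v. if v \<in> V then A j (p v) + c j else 0)"
    have u: "u j \<in> trivial_flexes V p" if "j < ?m" for j
      unfolding u_def by (rule trivial_flexesI[OF A[OF that]])
    have "flex_coord (u j) i = flex_coord (\<lambda>v. A j (p v) + c j) i"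
      if "j \<in> {..<?m}" "i \<in> V \<times> {1..d}" for j i
      using that by (auto simp: u_def flex_coord_def)
    then have "indep_family {..<?m} (V \<times> {1..d}) (\<lambda>j. flex_coord (u j))"
      using ind indep_family_cong[of "{..<?m}" "V \<times> {1..d}" "\<lambda>j. flex_coord (u j)"
            "\<lambda>j. flex_coord (\<lambda>v. A j (p v) + c j)"] by blast
    moreover have "u j v = 0" if "j \<in> {..<?m}" "v \<notin> V" for j v
      using that by (simp add: u_def)
    ultimately have ind_u: "inj_on u {..<?m} \<and> independent (u ` {..<?m})"
      using indep_family_flex_coord_iff[of "{..<?m}" V u] independent_image_iff[of "{..<?m}" u]
      by blast
    obtain B where B: "B \<subseteq> trivial_flexes V p" "independent B"
      "trivial_flexes V p \<subseteq> span B" "card B = dim (trivial_flexes V p)"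
      using real_vector.basis_exists by blast
    \<comment> \<open>Stated for finite subsets of \<open>B\<close>, because the uniform bound is
      what shows that \<open>B\<close> itself is finite.\<close>
    have bound: "card E + card G \<le> d * card V" if G: "G \<subseteq> B" "finite G" for G
    proof (rule card_edges_flexes_le[OF graph G(2) rows, where u = "\<lambda>u. u"])
      show "x \<in> trivial_flexes V p" if "x \<in> G" for x using that G B(1) by blast
      have "inj_on (\<lambda>u. u) G \<and> independent ((\<lambda>u. u) ` G)"
        using real_vector.independent_mono[OF B(2) G(1)] by simp
      moreover have "x v = 0" if "x \<in> G" "v \<notin> V" for x v
        using that G(1) B(1) by (fastforce simp: trivial_flexes_def)
      ultimately show "indep_family G (V \<times> {1..d}) (\<lambda>x. flex_coord x)"
        using indep_family_flex_coord_iff[of G V "\<lambda>u. u"] independent_image_iff[OF G(2), of "\<lambda>u. u"]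
        by blast
    qed
    \<comment> \<open>This makes the truncated subtraction in \<open>?m\<close> agree with the
      integer difference in \<open>rigid_framework\<close>.\<close>
    have cE: "card E \<le> d * card V" using bound[of "{}"] by simp
    have "finite B \<and> card B \<le> ?m"
      using bound by (intro finite_if_finite_subsets_card_bdd) (metis add_le_imp_le_diff add.commute)
    moreover have "u ` {..<?m} \<subseteq> span B" using u B(3) by blast
    then have "card (u ` {..<?m}) \<le> card B"
      using real_vector.independent_span_bound[of B "u ` {..<?m}"] ind_u calculation by blast
    then have "?m \<le> card B" using ind_u by (simp add: card_image)
    ultimately have dim: "dim (trivial_flexes V p) = ?m" using B(4) by simp
    have "rigidity_rank b E q \<le> card E" for q
      using real_vector.dim_le_card'[of "rigidity_row b q ` E"] card_image_le[of E "rigidity_row b q"] fin(2)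
      by (simp add: rigidity_rank_def)
    then have "rigid_framework b V E p"
      using p cE by (simp add: rigid_framework_def regular_framework_def rank[OF p] independent_framework_def
          dim_tangent_space_orbit[OF config] dim of_nat_diff flip: dim_UNIV)
    then show "minimally_rigid_graph b V E"
      using p by (auto simp: minimally_rigid_graph_def minimally_rigid_framework_def)
  }
qed

text \<open>Restricted to the columns of the new vertex, the rows of the new edges are independent and
  the remaining rows vanish.\<close>

lemma indep_family_rows_extension:
  fixes q :: "'v \<Rightarrow> 'a"
  assumes graph: "finite_simple_graph V E" and S: "finite S" "S \<subseteq> V" and v0: "v0 \<notin> V"
    and rows: "indep_family E (V \<times> {1..d}) (rigidity_row b q)"
    and phi: "indep_family S {1..d} (\<lambda>w k. \<phi> (q v0 - q w) (b k))"
  shows "indep_family (E \<union> {{v0, w} | w. w \<in> S}) (insert v0 V \<times> {1..d}) (rigidity_row b q)"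
proof (rule indep_familyI)
  fix c e
  let ?N = "{{v0, w} | w. w \<in> S}"
  assume c: "\<And>i. i \<in> insert v0 V \<times> {1..d} \<Longrightarrow> (\<Sum>e\<in>E \<union> ?N. c e * rigidity_row b q e i) = 0"
    and e: "e \<in> E \<union> ?N"
  have N: "?N = (\<lambda>w. {v0, w}) ` S" by auto
  have inj: "inj_on (\<lambda>w. {v0, w}) S" by (auto simp: inj_on_def doubleton_eq_iff)
  have old: "v0 \<notin> e" if "e \<in> E" for e
    using v0 that by (auto elim!: finite_simple_graph_edgeE[OF graph])
  have split: "(\<Sum>e\<in>E \<union> ?N. c e * rigidity_row b q e i) =
      (\<Sum>e\<in>E. c e * rigidity_row b q e i) + (\<Sum>w\<in>S. c {v0, w} * rigidity_row b q {v0, w} i)" for i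
    using finite_simple_graph_finite(2)[OF graph] S(1) old
    by (subst sum.union_disjoint) (auto simp: N sum.reindex[OF inj])
  have new: "c {v0, w} = 0" if "w \<in> S" for w
  proof (rule indep_familyD[OF phi _ that])
    fix k assume k: "k \<in> {1..d}"
    have "(\<Sum>e\<in>E. c e * rigidity_row b q e (v0, k)) = 0"
      using old by (intro sum.neutral) (simp add: rigidity_row_eq_0)
    then show "(\<Sum>w\<in>S. c {v0, w} * \<phi> (q v0 - q w) (b k)) = 0"
      using c[of "(v0, k)"] k unfolding split by (simp add: rigidity_row_endpoint)
  qed
  then have "(\<Sum>e\<in>E. c e * rigidity_row b q e i) = 0" if "i \<in> V \<times> {1..d}" for i
    using c[of i] that unfolding split by auto
  then have "c e = 0" if "e \<in> E" for e using indep_familyD[OF rows] that by blast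
  then show "c e = 0" using e new by auto
qed

lemma finite_simple_graph_zero_extension:
  assumes graph: "finite_simple_graph V E" and S: "S \<subseteq> V" and v0: "v0 \<notin> V"
  shows "finite_simple_graph (insert v0 V) (E \<union> {{v0, w} | w. w \<in> S})"
    and "card (E \<union> {{v0, w} | w. w \<in> S}) = card E + card S"
proof -
  let ?N = "{{v0, w} | w. w \<in> S}"
  note fin = finite_simple_graph_finite[OF graph]
  show "finite_simple_graph (insert v0 V) (E \<union> ?N)"
    unfolding finite_simple_graph_def
  proof (intro conjI ballI)
    fix e assume "e \<in> E \<union> ?N"
    then consider "e \<in> E" | w where "w \<in> S" "e = {v0, w}" by blast
    then show "\<exists>v w. v \<in> insert v0 V \<and> w \<in> insert v0 V \<and> v \<noteq> w \<and> e = {v, w}"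
    proof cases
      case 1
      then show ?thesis using finite_simple_graph_edgeE[OF graph] by (metis insertCI)
    next
      case 2
      then show ?thesis using S v0 by blast
    qed
  qed (use fin in simp)
  have N: "?N = (\<lambda>w. {v0, w}) ` S" by auto
  have "inj_on (\<lambda>w. {v0, w}) S" by (auto simp: inj_on_def doubleton_eq_iff)
  then have "card ?N = card S" unfolding N by (rule card_image)
  moreover have "E \<inter> ?N = {}" using v0 by (auto simp: doubleton_eq_iff elim!: finite_simple_graph_edgeE[OF graph])
  moreover have "finite ?N" using finite_subset[OF S fin(1)] by (simp add: N)
  ultimately show "card (E \<union> ?N) = card E + card S" using fin(2) by (simp add: card_Un_disjoint)
qed

lemma open_property_rows:
  assumes "finite_simple_graph V E"
  shows "open_property (\<lambda>p. indep_family E I (rigidity_row b p))"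
  unfolding open_property_def
proof (intro allI impI)
  fix p q assume ind: "indep_family E I (rigidity_row b p)" and q: "\<forall>v. (\<lambda>n. q n v) \<longlonglongrightarrow> p v"
  show "\<forall>\<^sub>F n in sequentially. indep_family E I (rigidity_row b (q n))"
  proof (rule indep_family_eventually[OF finite_simple_graph_finite(2)[OF assms] ind])
    fix e i assume "e \<in> E"
    then obtain x y where "e = {x, y}" using finite_simple_graph_edgeE[OF assms] by blast
    then show "(\<lambda>n. rigidity_row b (q n) e i) \<longlonglongrightarrow> rigidity_row b p e i"
      using q by (simp add: tendsto_rigidity_row)
  qed
qed

lemma open_property_flexes:
  fixes A :: "'j \<Rightarrow> 'a \<Rightarrow> 'a" and I :: "('v \<times> nat) set"
  assumes "finite J" "\<And>j. j \<in> J \<Longrightarrow> linear (A j)"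
  shows "open_property (\<lambda>p. indep_family J I (\<lambda>j. flex_coord (\<lambda>v. A j (p v) + c j)))"
  unfolding open_property_def
proof (intro allI impI)
  fix p q assume ind: "indep_family J I (\<lambda>j. flex_coord (\<lambda>v. A j (p v) + c j))"
    and q: "\<forall>v. (\<lambda>n. q n v) \<longlonglongrightarrow> p v"
  show "\<forall>\<^sub>F n in sequentially. indep_family J I (\<lambda>j. flex_coord (\<lambda>v. A j (q n v) + c j))"
  proof (rule indep_family_eventually[OF assms(1) ind])
    fix j and i :: "'v \<times> nat" assume j: "j \<in> J"
    obtain v k where i: "i = (v, k)" by fastforce
    show "(\<lambda>n. flex_coord (\<lambda>v. A j (q n v) + c j) i) \<longlonglongrightarrow> flex_coord (\<lambda>v. A j (p v) + c j) i"
      unfolding i flex_coord_def prod.case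
      by (intro tendsto_linear[OF linear_coord] tendsto_add tendsto_linear[OF assms(2)[OF j]]
          tendsto_const q[rule_format])
  qed
qed

lemma independent_with_flexes_zero_extension:
  fixes V :: "'v set"
  assumes graph: "finite_simple_graph V E" and S: "S \<subseteq> V" "card S = d" and v0: "v0 \<notin> V"
    and V': "V' = insert v0 V" and E': "E' = E \<union> {{v0, w} | w. w \<in> S}"
  shows "independent_with_flexes V E m \<longleftrightarrow> independent_with_flexes V' E' m"
proof
  have finS: "finite S" using finite_subset[OF S(1) finite_simple_graph_finite(1)[OF graph]] .
  have graph': "finite_simple_graph V' E'"
    unfolding V' E' by (rule finite_simple_graph_zero_extension[OF graph S(1) v0])
  {
    assume "independent_with_flexes V E m"
    then obtain p :: "'v \<Rightarrow> 'a" and A c where p: "placement V E p"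
      "indep_family E (V \<times> {1..d}) (rigidity_row b p)"
      and A: "\<And>j. j < m \<Longrightarrow> A j \<in> killing"
      and flexes: "indep_family {..<m} (V \<times> {1..d}) (\<lambda>j. flex_coord (\<lambda>v. A j (p v) + c j))"
      unfolding independent_with_flexes_def independent_framework_iff[OF graph] by blast
    have "open_property (\<lambda>p. (\<forall>v w. {v, w} \<in> E \<longrightarrow> p v \<noteq> p w) \<and>
        indep_family E (V \<times> {1..d}) (rigidity_row b p) \<and>
        indep_family {..<m} (V \<times> {1..d}) (\<lambda>j. flex_coord (\<lambda>v. A j (p v) + c j)))" (is "open_property ?P")
      using A by (intro open_property_conj open_property_edges_distinct[OF graph]
          open_property_rows[OF graph] open_property_flexes) (auto intro: killing_linear)
    moreover have "?P p" using p flexes by (simp add: placement_def)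
    \<comment> \<open>The new vertex is put at the origin, the value that
      \<open>config_space V\<close> already assigns to \<open>v0\<close>.\<close>
    ultimately obtain q where q: "?P q" "\<And>v. v \<notin> S \<Longrightarrow> q v = p v"
      "indep_family S {1..d} (\<lambda>w k. \<phi> (0 - q w) (b k))"
      using perturb_to_independent_phi[of ?P p S 0] finS S(2) by blast
    have config: "q v = 0" if "v \<notin> V" for v
      using q(2)[of v] p(1) S(1) that by (auto simp: placement_def config_space_def)
    \<comment> \<open>An independent family has no zero member, and \<open>\<phi> 0\<close>
      vanishes; so the new edges have distinct ends.\<close>
    have "q w \<noteq> 0" if "w \<in> S" for w
    proof
      assume "q w = 0"
      then have "\<phi> (0 - q w) (b k) = 0" for k
        using abs_phi_le[of 0 "b k"] by simp
      then have "(\<Sum>v\<in>S. (if v = w then 1 else 0) * \<phi> (0 - q v) (b k)) = 0" for k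
        by (intro sum.neutral) auto
      from indep_familyD[OF q(3) this that] show False by simp
    qed
    then have "placement V' E' q"
      using q(1) config[OF v0] config by (auto simp: placement_def config_space_def V' E' doubleton_eq_iff)
    moreover have "indep_family E' (V' \<times> {1..d}) (rigidity_row b q)"
      unfolding V' E' using q(1,3) config[OF v0]
      by (intro indep_family_rows_extension[OF graph finS S(1) v0]) simp_all
    moreover have "indep_family {..<m} (V' \<times> {1..d}) (\<lambda>j. flex_coord (\<lambda>v. A j (q v) + c j))"
      using q(1) by (auto intro: indep_family_mono simp: V')
    ultimately show "independent_with_flexes V' E' m"
      unfolding independent_with_flexes_def independent_framework_iff[OF graph'] using A by blast
  }
  {
    assume "independent_with_flexes V' E' m"
    then obtain p :: "'v \<Rightarrow> 'a" and A c where p: "placement V' E' p"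
      "indep_family E' (V' \<times> {1..d}) (rigidity_row b p)"
      and A: "\<And>j. j < m \<Longrightarrow> A j \<in> killing"
      and flexes: "indep_family {..<m} (V' \<times> {1..d}) (\<lambda>j. flex_coord (\<lambda>v. A j (p v) + c j))"
      unfolding independent_with_flexes_def independent_framework_iff[OF graph'] by blast
    \<comment> \<open>The rows of the new edges also have entries at \<open>S\<close>, so their
      parts at \<open>v0\<close> may be dependent even though the rows of \<open>E'\<close> are
      independent. The points of \<open>S\<close> are therefore perturbed again, with
      \<open>p v0\<close> kept.\<close>
    have "open_property (\<lambda>p. (\<forall>v w. {v, w} \<in> E' \<longrightarrow> p v \<noteq> p w) \<and>
        indep_family E' (V' \<times> {1..d}) (rigidity_row b p) \<and>
        indep_family {..<m} (V' \<times> {1..d}) (\<lambda>j. flex_coord (\<lambda>v. A j (p v) + c j)))" (is "open_property ?P")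
      using A by (intro open_property_conj open_property_edges_distinct[OF graph']
          open_property_rows[OF graph'] open_property_flexes) (auto intro: killing_linear)
    moreover have "?P p" using p flexes by (simp add: placement_def)
    ultimately obtain q where q: "?P q" "\<And>v. v \<notin> S \<Longrightarrow> q v = p v"
      "indep_family S {1..d} (\<lambda>w k. \<phi> (p v0 - q w) (b k))"
      using perturb_to_independent_phi[of ?P p S "p v0"] finS S(2) by blast
    have qv0: "q v0 = p v0" using q(2) S(1) v0 by blast
    define r where "r = q(v0 := 0)"
    have r: "r v = q v" if "v \<in> V" for v using that v0 by (auto simp: r_def)
    have edge: "\<exists>x y. e = {x, y} \<and> x \<in> V \<and> y \<in> V" if "e \<in> E" for e
      using finite_simple_graph_edgeE[OF graph that] by blast
    have config: "r v = 0" if "v \<notin> V" for v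
    proof -
      have "q v = p v" using q(2) S(1) that by blast
      then show ?thesis using p(1) that by (auto simp: r_def placement_def config_space_def V')
    qed
    have "r v \<noteq> r w" if "{v, w} \<in> E" for v w
    proof -
      have "v \<in> V" "w \<in> V" using edge[OF that] by (auto simp: doubleton_eq_iff)
      then show ?thesis using q(1) that r by (simp add: E')
    qed
    then have "placement V E r" using config by (auto simp: placement_def config_space_def)
    moreover have "indep_family E (V \<times> {1..d}) (rigidity_row b r)"
    proof -
      have row: "rigidity_row b r e = rigidity_row b q e" if "e \<in> E" for e
      proof -
        from edge[OF that] obtain x y where e: "e = {x, y}" "x \<in> V" "y \<in> V" by blast
        show ?thesis unfolding e(1) using r e(2,3) by (intro rigidity_row_cong) auto
      qed
      have "indep_family E (V' \<times> {1..d}) (rigidity_row b q)"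
        using indep_family_subset[of E' _ "rigidity_row b q" E] q(1)
          finite_simple_graph_finite(2)[OF graph'] by (simp add: E')
      then have "indep_family E (V \<times> {1..d}) (rigidity_row b q)"
      proof (rule indep_family_drop)
        fix e i assume e: "e \<in> E" and "i \<in> V' \<times> {1..d} - V \<times> {1..d}"
        then obtain k where i: "i = (v0, k)" by (auto simp: V')
        have "v0 \<notin> e" using edge[OF e] v0 by auto
        then show "rigidity_row b q e i = 0" by (simp add: i rigidity_row_eq_0)
      qed
      then show ?thesis using indep_family_cong[of E "V \<times> {1..d}" "rigidity_row b r" "rigidity_row b q"] row
        by simp
    qed
    moreover have "indep_family {..<m} (V \<times> {1..d}) (\<lambda>j. flex_coord (\<lambda>v. A j (r v) + c j))"
    proof (rule indep_familyI)
      fix a j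
      assume a: "\<And>i. i \<in> V \<times> {1..d} \<Longrightarrow> (\<Sum>j<m. a j * flex_coord (\<lambda>v. A j (r v) + c j) i) = 0"
        and j: "j \<in> {..<m}"
      \<comment> \<open>A relation between the flexes on \<open>V\<close> combines the given fields
        into a single field \<open>B x + t\<close> that vanishes at all points of \<open>V\<close>.
        Subtracting its value at \<open>q w\<close> shows that its value at \<open>p v0\<close> is
        \<open>B (p v0 - q w)\<close>, which the corresponding functional annihilates.\<close>
      define B where "B = (\<lambda>x. \<Sum>j<m. a j *\<^sub>R A j x)"
      define t where "t = (\<Sum>j<m. a j *\<^sub>R c j)"
      have B: "B \<in> killing" unfolding B_def using A by (intro killing_sum) simp
      have coord: "(\<Sum>j<m. a j * flex_coord (\<lambda>v. A j (x v) + c j) (v, k)) = coord k (B (x v) + t)" for x v k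
        by (simp add: flex_coord_def B_def t_def linear_sum[OF linear_coord] linear_cmul[OF linear_coord]
            linear_add[OF linear_coord] distrib_left sum.distrib)
      have zero: "B (q v) + t = 0" if "v \<in> V" for v
        using a[of "(v, _)"] r[OF that] that
        by (intro coord_eqI) (simp add: coord linear_0[OF linear_coord])
      have "\<phi> (p v0 - q w) (B (p v0) + t) = 0" if "w \<in> S" for w
      proof -
        have "t = - B (q w)" using zero[of w] that S(1) by (auto simp: add_eq_0_iff)
        then have "B (p v0) + t = B (p v0 - q w)" by (simp add: linear_diff[OF killing_linear[OF B]])
        then show ?thesis using killing_phi[OF B] by simp
      qed
      then have "B (p v0) + t = 0"
        by (intro annihilated_by_phi_family[OF finS S(2) q(3)] linear_phi)
      then have "B (q v) + t = 0" if "v \<in> V'" for v using zero that qv0 by (auto simp: V')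
      then have "(\<Sum>j<m. a j * flex_coord (\<lambda>v. A j (q v) + c j) i) = 0" if "i \<in> V' \<times> {1..d}" for i
        using that by (auto simp: coord linear_0[OF linear_coord])
      then show "a j = 0" using indep_familyD[of "{..<m}" "V' \<times> {1..d}"] q(1) j by blast
    qed
    ultimately show "independent_with_flexes V E m"
      unfolding independent_with_flexes_def independent_framework_iff[OF graph] using A by blast
  }
qed

end

theorem proposition4p3:
  fixes b :: "nat \<Rightarrow> 'a::real_normed_vector"
    and d :: nat
    and V V' S :: "'v set"
    and E E' :: "'v set set"
  assumes finite_dim: "\<exists>B :: 'a set. finite B \<and> span B = UNIV"
    and smooth: "smooth_space TYPE('a)"
    and strictly_convex: "strictly_convex_space TYPE('a)"
    and d: "d = dim (UNIV :: 'a set)"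
    and basis: "ordered_basis b"
    and graph: "finite_simple_graph V E"
    and extension: "zero_extension d S V E V' E'"
  shows "(independent_graph b V E \<longleftrightarrow> independent_graph b V' E') \<and>
         (minimally_rigid_graph b V E \<longleftrightarrow> minimally_rigid_graph b V' E')"
proof -
  interpret smooth_strictly_convex b d
    using d basis smooth strictly_convex by unfold_locales
  obtain v0 where S: "S \<subseteq> V" "card S = d" and v0: "v0 \<notin> V"
    and V': "V' = insert v0 V" and E': "E' = E \<union> {{v0, w} | w. w \<in> S}"
    using extension unfolding zero_extension_def by blast
  note ext = finite_simple_graph_zero_extension[OF graph S(1) v0, folded V' E']
  have "card V' = Suc (card V)"
    using finite_simple_graph_finite(1)[OF graph] v0 by (simp add: V')
  \<comment> \<open>Both terms grow by \<open>d\<close>, so the required number of flexes is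
    unchanged, also under truncated subtraction.\<close>
  then have "d * card V' - card E' = d * card V - card E"
    using ext(2) S(2) by simp
  then show ?thesis
    using independent_with_flexes_zero_extension[OF graph S v0 V' E']
    by (simp add: independent_graph_iff minimally_rigid_graph_iff[OF graph] minimally_rigid_graph_iff[OF ext(1)])
qed

end
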